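(* Let $K$ be a field with $\operatorname{char}K\neq 2$, let $\Phi=A_l$, and consider the action of $G_0$ on $V_1$ defined in the context. Put $\rho=\alpha_1$ if $l\ge 2$ and $\sigma=\alpha_l$ if $l\ge 3$. (1) If $l=1$, then $V_1=0$ and there is exactly one orbit, $\{0\}$. (2) If $l=2$, then $\Phi_1=\{\rho,\delta-\rho\}$ and every vector $x^\rho e_\rho+x^{\delta-\rho}e_{\delta-\rho}$ with $x^\rho,x^{\delta-\rho}\in K$ forms an orbit consisting of one element. (3) If $l=3$, then every $x\in V_1$ can be transformed by $G_0$ to a vector of one of the following forms: I. $0$; IIa. $e_\rho$; IIb. $e_\sigma$; III. $e_\rho+x^\sigma e_\sigma$ with $x^\sigma\in K$, $x^\sigma\neq0$; VI. $e_\rho+x^{\delta-\rho}e_{\delta-\rho}$ with $x^{\delta-\rho}\in K$, $x^{\delta-\rho}\ne0$. Moreover, all these vectors (for all distinct types and all distinct values of the parameters) lie in pairwise different $G_0$-orbits. (4) If $l>3$, then every $x\in V_1$ can be transformed by $G_0$ to a vector of one of the following forms: I. $0$; IIa. $e_\rho$; IIb. $e_\sigma$; III. $e_\rho+e_\sigma$; VI. $e_\rho+x^{\delta-\rho}e_{\delta-\rho}$ with $x^{\delta-\rho}\in K$, $x^{\delta-\rho}\ne0$. Moreover, all these vectors (for all distinct types and all distinct values of the parameter) lie in pairwise different $G_0$-orbits.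
   Context: The simple roots $\alpha_1,\dots,\alpha_l$ of $A_l$ are numbered consecutively along the Dynkin diagram; $\delta=\alpha_1+\dots+\alpha_l$ is the maximal root. $V=V(\Phi)$ is the Lie algebra of type $\Phi$ over $K$ (the $\mathbb Z$-span of a Chevalley basis $\{e_\alpha,\alpha\in\Phi;\ h_\alpha,\alpha\in\Pi\}$ tensored with $K$), where $\Pi$ is the set of simple roots. $G=G_{\rm sc}(\Phi,K)$ is the simply connected Chevalley group of type $\Phi$ over $K$, generated by the elementary root elements $x_\alpha(a)$, $\alpha\in\Phi$, $a\in K$, acting on $V$ by the adjoint action. Put $\Phi_0=\{\alpha\in\Phi:\alpha\perp\delta\}$ and $\Phi_1=\{\alpha\in\Phi:\angle(\alpha,\delta)=\pi/3\}$. Then $G_0=G_{\rm sc}(\Phi_0,K)$ is the subgroup of $G$ generated by all $x_\alpha(a)$ with $\alpha\in\Phi_0$, $a\in K$ (trivial if $\Phi_0$ is empty), and $V_1$ is the $K$-span of the $e_\alpha$, $\alpha\in\Phi_1$; the group $G_0$ acts on $V_1$ by restriction of the action of $G$ on $V$. *)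

theory Defs
  imports
    Complex_Main
    "HOL-Algebra.Group_Action"
    "HOL-Algebra.Generated_Groups"
    "Jordan_Normal_Form.VS_Connect"
begin

section \<open>The root system of type A\<close>

text \<open>
  Type \<open>A\<^sub>l\<close> is realised by the vectors \<open>\<epsilon>\<^sub>i - \<epsilon>\<^sub>j\<close> in Euclidean \<open>(l+1)\<close>-space; their coordinates
  are integers, so roots are integer vectors of dimension \<open>l+1\<close>.  Coordinates are counted from \<open>0\<close>,
  simple roots from \<open>1\<close>.
\<close>

definition roots :: "nat \<Rightarrow> int vec set" where
  "roots l = {unit_vec (Suc l) i - unit_vec (Suc l) j | i j. i < Suc l \<and> j < Suc l \<and> i \<noteq> j}"

definition simple_root :: "nat \<Rightarrow> nat \<Rightarrow> int vec" where
  "simple_root l i = unit_vec (Suc l) (i - 1) - unit_vec (Suc l) i"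

definition max_root :: "nat \<Rightarrow> int vec" where
  "max_root l = finsum_vec TYPE(int) (Suc l) (simple_root l) {1..l}"

definition root_angle :: "int vec \<Rightarrow> int vec \<Rightarrow> real" where
  "root_angle \<alpha> \<beta> =
     arccos (of_int (\<alpha> \<bullet> \<beta>) / (sqrt (of_int (\<alpha> \<bullet> \<alpha>)) * sqrt (of_int (\<beta> \<bullet> \<beta>))))"

definition Phi0 :: "nat \<Rightarrow> int vec set" where
  "Phi0 l = {\<alpha> \<in> roots l. \<alpha> \<bullet> max_root l = 0}"

definition Phi1 :: "nat \<Rightarrow> int vec set" where
  "Phi1 l = {\<alpha> \<in> roots l. root_angle \<alpha> (max_root l) = pi / 3}"


section \<open>Chevalley bases\<close>

text \<open>
  The simple Lie algebra of type \<open>A\<^sub>l\<close> is \<open>sl\<^sub>l\<^sub>+\<^sub>1\<close> with the diagonal Cartan subalgebra.  As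
  \<open>(\<alpha>,\<alpha>) = 2\<close> for every root, the element \<open>h\<^sub>\<alpha>\<close> of the Cartan subalgebra is the diagonal matrix with
  the coordinates of \<open>\<alpha>\<close>, and \<open>\<beta>(h\<^sub>\<alpha>) = (\<beta>,\<alpha>)\<close>.  A Chevalley basis is determined by its root vectors
  \<open>e\<^sub>\<alpha>\<close>.  Up to an automorphism by a diagonal matrix, each one has integer matrices as root vectors, so
  that the \<open>\<int>\<close>-span of the basis is \<open>sl\<^sub>l\<^sub>+\<^sub>1(\<int>)\<close>; only the signs of the \<open>e\<^sub>\<alpha>\<close> are not fixed.
\<close>

definition lie_bracket :: "int mat \<Rightarrow> int mat \<Rightarrow> int mat" where
  "lie_bracket A B = A * B - B * A"

definition cartan_elt :: "nat \<Rightarrow> int vec \<Rightarrow> int mat" where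
  "cartan_elt l \<alpha> = mat_diag (Suc l) (\<lambda>k. \<alpha> $ k)"

definition chevalley_basis :: "nat \<Rightarrow> (int vec \<Rightarrow> int mat) \<Rightarrow> bool" where
  "chevalley_basis l e \<longleftrightarrow>
     (\<forall>\<alpha>\<in>roots l. e \<alpha> \<in> carrier_mat (Suc l) (Suc l)) \<and>
     (\<forall>\<alpha>\<in>roots l. \<forall>i\<in>{1..l}.
        lie_bracket (cartan_elt l (simple_root l i)) (e \<alpha>) = (\<alpha> \<bullet> simple_root l i) \<cdot>\<^sub>m e \<alpha>) \<and>
     (\<forall>\<alpha>\<in>roots l. lie_bracket (e \<alpha>) (e (- \<alpha>)) = cartan_elt l \<alpha>) \<and>
     (\<forall>\<alpha>\<in>roots l. \<forall>\<beta>\<in>roots l. \<alpha> + \<beta> \<in> roots l \<longrightarrow>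
        (\<exists>s\<in>{1, - 1}. lie_bracket (e \<alpha>) (e \<beta>) =
           (s * (int (GREATEST p. \<beta> - int p \<cdot>\<^sub>v \<alpha> \<in> roots l) + 1)) \<cdot>\<^sub>m e (\<alpha> + \<beta>)))"

text \<open>The usual matrix units form such a basis, so the notion is not vacuous.\<close>

definition elem_mat :: "nat \<Rightarrow> nat \<Rightarrow> nat \<Rightarrow> int mat" where
  "elem_mat n i j = mat n n (\<lambda>p. if p = (i, j) then 1 else 0)"

definition standard_basis :: "nat \<Rightarrow> int vec \<Rightarrow> int mat" where
  "standard_basis l \<alpha> =
     mat (Suc l) (Suc l) (\<lambda>(i, j). if \<alpha> = unit_vec (Suc l) i - unit_vec (Suc l) j then 1 else 0)"

lemma root_index: "k < n \<Longrightarrow> (unit_vec n i - unit_vec n j :: int vec) $ k = of_bool (k = i) - of_bool (k = j)"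
  by (auto simp: unit_vec_def)

lemma root_eq_iff:
  assumes "i < n" "j < n" "a < n" "b < n" "i \<noteq> j"
  shows "(unit_vec n i - unit_vec n j :: int vec) = unit_vec n a - unit_vec n b \<longleftrightarrow> i = a \<and> j = b"
proof
  assume eq: "(unit_vec n i - unit_vec n j :: int vec) = unit_vec n a - unit_vec n b"
  have "(of_bool (k = i) - of_bool (k = j) :: int) = of_bool (k = a) - of_bool (k = b)" if "k < n" for k
    using that arg_cong[OF eq, of "\<lambda>v. v $ k"] by (simp add: root_index del: index_minus_vec)
  from this[of i] this[of j] show "i = a \<and> j = b" using assms
    by (auto simp: of_bool_def split: if_splits)
qed auto

lemma standard_basis_root:
  assumes "i < Suc l" "j < Suc l" "i \<noteq> j"
  shows "standard_basis l (unit_vec (Suc l) i - unit_vec (Suc l) j) = elem_mat (Suc l) i j"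
  unfolding standard_basis_def elem_mat_def
  by (rule cong_mat) (use assms root_eq_iff in auto)

lemma elem_mat_mult:
  assumes "i < n" "j < n" "k < n" "m < n"
  shows "elem_mat n i j * elem_mat n k m = (if j = k then elem_mat n i m else 0\<^sub>m n n)"
  by (rule eq_matI)
    (use assms in \<open>auto simp: elem_mat_def scalar_prod_def if_distrib[of "\<lambda>x. x * _"] sum.delta
      if_distrib[of "\<lambda>x. _ * x"] cong: if_cong intro!: sum.neutral\<close>)

lemma root_bounds:
  assumes "\<alpha> \<in> roots l" "k < Suc l"
  shows "\<alpha> $ k \<le> 1" "\<alpha> $ k \<ge> - 1"
  using assms by (auto simp: roots_def root_index simp del: index_minus_vec)

lemma elem_mat_carrier [simp]: "elem_mat n i j \<in> carrier_mat n n"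
  by (simp add: elem_mat_def)

lemma chevalley_basis_standard: "chevalley_basis l (standard_basis l)"
  unfolding chevalley_basis_def
proof (intro conjI ballI impI)
  let ?n = "Suc l"
  let ?r = "\<lambda>i j. unit_vec ?n i - unit_vec ?n j :: int vec"
  fix \<alpha> assume "\<alpha> \<in> roots l"
  then obtain i j where \<alpha>: "\<alpha> = ?r i j" and ij: "i < ?n" "j < ?n" "i \<noteq> j"
    by (auto simp: roots_def)
  note e\<alpha> = standard_basis_root[OF ij, folded \<alpha>]
  show "standard_basis l \<alpha> \<in> carrier_mat ?n ?n" by (simp add: e\<alpha>)
  have neg: "- \<alpha> = ?r j i" by (auto simp: \<alpha>)
  show "lie_bracket (standard_basis l \<alpha>) (standard_basis l (- \<alpha>)) = cartan_elt l \<alpha>"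
    unfolding e\<alpha> neg standard_basis_root[OF ij(2,1) ij(3)[symmetric]] lie_bracket_def
    by (simp add: elem_mat_mult ij, rule eq_matI)
      (use ij in \<open>auto simp: elem_mat_def cartan_elt_def mat_diag_def \<alpha> unit_vec_def\<close>)
  {
    fix t assume "t \<in> {1..l}"
    then have t: "t < ?n" "t - 1 < ?n" by auto
    let ?b = "simple_root l t"
    have "\<alpha> \<bullet> ?b = ?b $ i - ?b $ j"
      using ij t by (simp add: \<alpha> simple_root_def minus_scalar_prod_distrib[of _ ?n] scalar_prod_left_unit)
    then show "lie_bracket (cartan_elt l ?b) (standard_basis l \<alpha>) = (\<alpha> \<bullet> ?b) \<cdot>\<^sub>m standard_basis l \<alpha>"
      unfolding e\<alpha> lie_bracket_def cartan_elt_def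
      by (simp add: mat_diag_mult_left[of _ ?n ?n] mat_diag_mult_right[of _ ?n ?n])
        (rule eq_matI, auto simp: elem_mat_def)
  }
  fix \<beta> assume "\<beta> \<in> roots l" and sum: "\<alpha> + \<beta> \<in> roots l"
  then obtain k m where \<beta>: "\<beta> = ?r k m" and km: "k < ?n" "m < ?n" "k \<noteq> m"
    by (auto simp: roots_def)
  note e\<beta> = standard_basis_root[OF km, folded \<beta>]
  obtain a b where ab: "\<alpha> + \<beta> = ?r a b" "a < ?n" "b < ?n" "a \<noteq> b"
    using sum by (auto simp: roots_def)
  note e\<alpha>\<beta> = standard_basis_root[OF ab(2-4), folded ab(1)]
  have c: "(of_bool (q = i) - of_bool (q = j) + (of_bool (q = k) - of_bool (q = m)) :: int)
      = of_bool (q = a) - of_bool (q = b)" if "q < ?n" for q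
  proof -
    have "(\<alpha> + \<beta>) $ q = \<alpha> $ q + \<beta> $ q" using that by (simp add: \<beta>)
    then show ?thesis
      unfolding ab(1) unfolding \<alpha> \<beta> root_index[OF that] by (rule sym)
  qed
  have cases: "(j = k \<and> i \<noteq> m \<and> a = i \<and> b = m) \<or> (i = m \<and> j \<noteq> k \<and> a = k \<and> b = j)"
    using c[of a] c[of i] c[of j] c[of k] c[of m] ij km ab(2-4)
    by (auto simp: of_bool_def split: if_splits)
  have "p = 0" if "\<beta> - int p \<cdot>\<^sub>v \<alpha> \<in> roots l" for p
    using cases root_bounds[OF that, of j] root_bounds[OF that, of i] ij km
    by (auto simp: \<alpha> \<beta> unit_vec_def)
  moreover have "\<beta> - int 0 \<cdot>\<^sub>v \<alpha> = \<beta>" by (auto simp: \<alpha> \<beta>)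
  ultimately have p: "(GREATEST p. \<beta> - int p \<cdot>\<^sub>v \<alpha> \<in> roots l) = 0"
    using \<open>\<beta> \<in> roots l\<close> by (intro Greatest_equality) (metis, blast)
  show "\<exists>s\<in>{1, - 1}. lie_bracket (standard_basis l \<alpha>) (standard_basis l \<beta>) =
      (s * (int (GREATEST p. \<beta> - int p \<cdot>\<^sub>v \<alpha> \<in> roots l) + 1)) \<cdot>\<^sub>m standard_basis l (\<alpha> + \<beta>)"
    unfolding e\<alpha> e\<beta> e\<alpha>\<beta> lie_bracket_def p using cases ij km
    by (auto simp: elem_mat_mult intro!: eq_matI) (auto simp: elem_mat_def)
qed


section \<open>The Lie algebra and the Chevalley group over a field\<close>

definition root_vector :: "(int vec \<Rightarrow> int mat) \<Rightarrow> int vec \<Rightarrow> 'k::field mat" where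
  "root_vector e \<alpha> = map_mat of_int (e \<alpha>)"

abbreviation mat_span :: "nat \<Rightarrow> 'k::field mat set \<Rightarrow> 'k mat set" where
  "mat_span n \<equiv> LinearCombinations.module.span class_ring (module_mat TYPE('k) n n)"

text \<open>
  The \<open>\<int>\<close>-span of the Chevalley basis is a direct summand of the integer matrices, so tensoring it
  with the field amounts to taking the span of the images of the basis in the matrices over the field.
\<close>

definition lie_algebra :: "nat \<Rightarrow> (int vec \<Rightarrow> int mat) \<Rightarrow> 'k::field mat set" where
  "lie_algebra l e =
     mat_span (Suc l)
       (root_vector e ` roots l \<union> (\<lambda>i. map_mat of_int (cartan_elt l (simple_root l i))) ` {1..l})"

definition V1 :: "nat \<Rightarrow> (int vec \<Rightarrow> int mat) \<Rightarrow> 'k::field mat set" where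
  "V1 l e = mat_span (Suc l) (root_vector e ` Phi1 l)"

text \<open>
  The weights of the natural representation of \<open>sl\<^sub>l\<^sub>+\<^sub>1\<close> generate the whole weight lattice, so the
  Chevalley group constructed in this representation is the simply connected one.  In it
  \<open>e\<^sub>\<alpha>\<^sup>2 = 0\<close>, whence \<open>x\<^sub>\<alpha>(a) = exp (a e\<^sub>\<alpha>) = 1 + a e\<^sub>\<alpha>\<close>.
\<close>

definition root_elt :: "nat \<Rightarrow> (int vec \<Rightarrow> int mat) \<Rightarrow> int vec \<Rightarrow> 'k::field \<Rightarrow> 'k mat" where
  "root_elt l e \<alpha> a = 1\<^sub>m (Suc l) + a \<cdot>\<^sub>m root_vector e \<alpha>"

definition GL :: "nat \<Rightarrow> 'k::field mat monoid" where
  "GL n = units_of (ring_mat TYPE('k) n ())"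

definition chevalley_group :: "nat \<Rightarrow> (int vec \<Rightarrow> int mat) \<Rightarrow> 'k::field mat monoid" where
  "chevalley_group l e =
     (GL (Suc l))\<lparr>carrier := generate (GL (Suc l)) {root_elt l e \<alpha> a | \<alpha> a. \<alpha> \<in> roots l}\<rparr>"

definition G0 :: "nat \<Rightarrow> (int vec \<Rightarrow> int mat) \<Rightarrow> 'k::field mat monoid" where
  "G0 l e =
     (chevalley_group l e)
       \<lparr>carrier := generate (chevalley_group l e) {root_elt l e \<alpha> a | \<alpha> a. \<alpha> \<in> Phi0 l}\<rparr>"

definition adjoint_action ::
    "nat \<Rightarrow> (int vec \<Rightarrow> int mat) \<Rightarrow> 'k::field mat \<Rightarrow> 'k mat \<Rightarrow> 'k mat" where
  "adjoint_action l e g = (\<lambda>v\<in>lie_algebra l e. g * v * inv\<^bsub>chevalley_group l e\<^esub> g)"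

definition G0_action ::
    "nat \<Rightarrow> (int vec \<Rightarrow> int mat) \<Rightarrow> 'k::field mat \<Rightarrow> 'k mat \<Rightarrow> 'k mat" where
  "G0_action l e g = restrict (adjoint_action l e g) (V1 l e)"

abbreviation G0_orbit ::
    "nat \<Rightarrow> (int vec \<Rightarrow> int mat) \<Rightarrow> 'k::field mat \<Rightarrow> 'k mat set" where
  "G0_orbit l e \<equiv> orbit (G0 l e) (G0_action l e)"

abbreviation G0_orbits :: "nat \<Rightarrow> (int vec \<Rightarrow> int mat) \<Rightarrow> 'k::field mat set set" where
  "G0_orbits l e \<equiv> orbits (G0 l e) (V1 l e) (G0_action l e)"


section \<open>The normal forms\<close>

abbreviation rho :: "nat \<Rightarrow> int vec" where
  "rho l \<equiv> simple_root l 1"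

abbreviation sigma :: "nat \<Rightarrow> int vec" where
  "sigma l \<equiv> simple_root l l"

text \<open>
  The types are labels, so that saying that different labels or parameters give different orbits
  covers all pairs of distinct types and of distinct parameters.
\<close>

datatype 'k form3 = I3 | IIa3 | IIb3 | III3 'k | VI3 'k

definition forms3 :: "'k::field form3 set" where
  "forms3 = {I3, IIa3, IIb3} \<union> III3 ` {c. c \<noteq> 0} \<union> VI3 ` {c. c \<noteq> 0}"

fun form3_vector :: "(int vec \<Rightarrow> int mat) \<Rightarrow> 'k::field form3 \<Rightarrow> 'k mat" where
  "form3_vector e I3 = 0\<^sub>m 4 4"
| "form3_vector e IIa3 = root_vector e (rho 3)"
| "form3_vector e IIb3 = root_vector e (sigma 3)"
| "form3_vector e (III3 c) = root_vector e (rho 3) + c \<cdot>\<^sub>m root_vector e (sigma 3)"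
| "form3_vector e (VI3 c) = root_vector e (rho 3) + c \<cdot>\<^sub>m root_vector e (max_root 3 - rho 3)"

datatype 'k form = I | IIa | IIb | III | VI 'k

definition forms :: "'k::field form set" where
  "forms = {I, IIa, IIb, III} \<union> VI ` {c. c \<noteq> 0}"

fun form_vector :: "nat \<Rightarrow> (int vec \<Rightarrow> int mat) \<Rightarrow> 'k::field form \<Rightarrow> 'k mat" where
  "form_vector l e I = 0\<^sub>m (Suc l) (Suc l)"
| "form_vector l e IIa = root_vector e (rho l)"
| "form_vector l e IIb = root_vector e (sigma l)"
| "form_vector l e III = root_vector e (rho l) + root_vector e (sigma l)"
| "form_vector l e (VI c) = root_vector e (rho l) + c \<cdot>\<^sub>m root_vector e (max_root l - rho l)"

end

theory Submission
  imports Defs "Jordan_Normal_Form.Column_Operations"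
begin

text \<open>
  Every root vector \<open>e\<^sub>\<alpha>\<close> with \<open>\<alpha> = \<epsilon>\<^sub>i - \<epsilon>\<^sub>j\<close> is a sign times the matrix unit \<open>E\<^sub>i\<^sub>j\<close>, and the maximal
  root is \<open>\<epsilon>\<^sub>0 - \<epsilon>\<^sub>l\<close>.  Hence an element of \<open>V\<^sub>1\<close> is a pair of a row \<open>u\<close> (entries \<open>(0, i)\<close>) and a column
  \<open>v\<close> (entries \<open>(i, l)\<close>), \<open>0 < i < l\<close>, on which \<open>G\<^sub>0\<close>, a copy of \<open>SL\<^sub>l\<^sub>-\<^sub>1\<close>, acts by
  \<open>u \<mapsto> u A\<inverse>, v \<mapsto> A v\<close>.  Elimination by transvections first turns a nonzero \<open>u\<close> into a multiple of a unit
  vector and then reduces \<open>v\<close> inside the stabilizer of \<open>u\<close>.  The orbits are separated by the vanishing of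
  \<open>u\<close>, the vanishing of \<open>v\<close> and the scalar product \<open>u v\<close>; for \<open>l = 3\<close> the symplectic form of \<open>SL\<^sub>2\<close>
  identifies columns with rows and yields one more invariant when \<open>u v = 0\<close>.
\<close>

section \<open>Transvections acting on a row and a column\<close>

text \<open>A step is the action of \<open>1 + a E\<^sub>i\<^sub>j\<close> on a row \<open>u\<close> and a column \<open>v\<close>.\<close>

inductive transv :: "nat set \<Rightarrow> (nat \<Rightarrow> 'k::field) \<Rightarrow> (nat \<Rightarrow> 'k) \<Rightarrow> (nat \<Rightarrow> 'k) \<Rightarrow> (nat \<Rightarrow> 'k) \<Rightarrow> bool"
  for S where
  refl: "transv S u v u v"
| step: "transv S u v u' v' \<Longrightarrow> i \<in> S \<Longrightarrow> j \<in> S \<Longrightarrow> i \<noteq> j \<Longrightarrow>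
    transv S u v (u'(j := u' j - a * u' i)) (v'(i := v' i + a * v' j))"

lemma transv_trans:
  assumes "transv S u v u' v'" "transv S u' v' u'' v''"
  shows "transv S u v u'' v''"
  using assms(2,1) by induction (auto intro: transv.step)

lemma transv_step:
  "i \<in> S \<Longrightarrow> j \<in> S \<Longrightarrow> i \<noteq> j \<Longrightarrow> transv S u v (u(j := u j - a * u i)) (v(i := v i + a * v j))"
  by (rule transv.step[OF transv.refl])

lemma transv_sym:
  assumes "transv S u v u' v'"
  shows "transv S u' v' u v"
  using assms
proof induction
  case (step u v u' v' i j a)
  from step(2-4) have "transv S (u'(j := u' j - a * u' i)) (v'(i := v' i + a * v' j)) u' v'"
    using transv_step[of i S j "u'(j := u' j - a * u' i)" "v'(i := v' i + a * v' j)" "- a"] by simp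
  from this step.IH show ?case by (rule transv_trans)
qed (rule transv.refl)

text \<open>With at most one index no step exists. This is the situation for l at most 2, where
  \<open>G0\<close> is trivial.\<close>

lemma transv_subsingleton:
  assumes "transv S u v u' v'" "\<And>i j. i \<in> S \<Longrightarrow> j \<in> S \<Longrightarrow> i = j"
  shows "u' = u \<and> v' = v"
  using assms by induction blast+

text \<open>The inverse transpose of 1 + a E_ij is 1 - a E_ji, and it exchanges the actions on rows
  and columns. What is proved for rows thereby becomes available for columns.\<close>

lemma transv_swap:
  assumes "transv S u v u' v'"
  shows "transv S v u v' u'"
  using assms
proof induction
  case (step u v u' v' i j a)
  from transv.step[OF step.IH step(3,2) step(4)[symmetric], of "- a"] show ?case
    by (simp only: minus_mult_left[symmetric] add_uminus_conv_diff diff_minus_eq_add)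
qed (rule transv.refl)

lemma transv_mono:
  assumes "transv S u v u' v'" "S \<subseteq> T"
  shows "transv T u v u' v'"
  using assms by induction (auto intro: transv.intros)

lemma transv_outside:
  assumes "transv S u v u' v'" "k \<notin> S"
  shows "u' k = u k \<and> v' k = v k"
  using assms by induction auto

section \<open>Invariants of chains of steps\<close>

lemma transv_zero:
  assumes "transv S u v u' v'" "\<forall>i\<in>S. u i = 0"
  shows "u' = u"
  using assms by induction auto

text \<open>A zero row stays zero; reversing the chain and exchanging rows with columns gives all
  the implications.\<close>

lemma transv_zero_iff:
  assumes "transv S u v u' v'"
  shows "(\<forall>i\<in>S. u' i = 0) \<longleftrightarrow> (\<forall>i\<in>S. u i = 0)"
    and "(\<forall>i\<in>S. v' i = 0) \<longleftrightarrow> (\<forall>i\<in>S. v i = 0)"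
  using transv_zero[OF assms] transv_zero[OF transv_sym[OF assms]]
    transv_zero[OF transv_swap[OF assms]] transv_zero[OF transv_swap[OF transv_sym[OF assms]]]
  by metis+

text \<open>This is (u A^-1)(A v) = u v. In a single step only the terms at \<open>i\<close> and
  \<open>j\<close> change, by a u_i v_j and its negative.\<close>

lemma transv_dot:
  assumes "transv S u v u' v'" "finite S"
  shows "(\<Sum>i\<in>S. u' i * v' i) = (\<Sum>i\<in>S. u i * v i)"
  using assms
proof induction
  case (step u v u' v' i j a)
  have "(\<Sum>k\<in>S. f k) = f i + f j + (\<Sum>k\<in>S - {i} - {j}. f k)" for f :: "nat \<Rightarrow> 'a"
    using step(2-4,6) by (simp add: sum.remove[of S i] sum.remove[of "S - {i}" j])
  note split = this
  have "(\<Sum>k\<in>S. (u'(j := u' j - a * u' i)) k * (v'(i := v' i + a * v' j)) k)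
     = (\<Sum>k\<in>S. u' k * v' k)"
    unfolding split using step(4) by (simp add: algebra_simps)
  with step show ?case by simp
qed simp

text \<open>On two indices \<open>SL\<^sub>2\<close> preserves the symplectic form, so that proportionality of \<open>v\<close> to the
  dual of \<open>u\<close>, together with the factor, is an invariant.\<close>

lemma transv_symplectic:
  assumes "transv {p, q} u v u' v'" "p \<noteq> q" "v p = - t * u q" "v q = t * u p"
  shows "v' p = - t * u' q \<and> v' q = t * u' p"
  using assms
proof induction
  case (step u v u' v' i j a)
  then have "v' p = - t * u' q" "v' q = t * u' p" by auto
  with step(2-4) \<open>p \<noteq> q\<close> show ?case by (auto simp: algebra_simps)
qed simp

section \<open>Elimination to normal form\<close>

text \<open>Multiples of the pivot \<open>u k\<close> are subtracted from the entries in
  \<open>T\<close>. All these steps have first index \<open>k\<close>, so the column is altered in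
  the entry at \<open>k\<close> only; this control is what later keeps a row already normalised in
  place.\<close>

lemma transv_clear:
  assumes "finite T" "T \<subseteq> S" "k \<in> S" "k \<notin> T" "u k \<noteq> 0"
  shows "\<exists>v'. transv S u v (\<lambda>i. if i \<in> T then 0 else u i) v' \<and> (\<forall>i. i \<noteq> k \<longrightarrow> v' i = v i)"
  using assms
proof (induction T)
  case empty
  then show ?case by (auto intro: transv.refl)
next
  case (insert j T)
  then obtain v' where v': "transv S u v (\<lambda>i. if i \<in> T then 0 else u i) v'"
    "\<forall>i. i \<noteq> k \<longrightarrow> v' i = v i" by auto
  let ?u = "\<lambda>i. if i \<in> T then 0 else u i"
  have "transv S u v (?u(j := ?u j - u j / u k * ?u k)) (v'(k := v' k + u j / u k * v' j))"
    using insert.prems by (intro transv.step[OF v'(1)]) auto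
  moreover have "?u(j := ?u j - u j / u k * ?u k) = (\<lambda>i. if i \<in> insert j T then 0 else u i)"
    using insert.prems insert.hyps by auto
  ultimately have "transv S u v (\<lambda>i. if i \<in> insert j T then 0 else u i) (v'(k := v' k + u j / u k * v' j))"
    by (simp only:)
  moreover have "\<forall>i. i \<noteq> k \<longrightarrow> (v'(k := v' k + u j / u k * v' j)) i = v i" using v'(2) by simp
  ultimately show ?case by blast
qed

text \<open>Transvections cannot rescale the entry at \<open>k\<close> directly. A nonzero entry at
  another index is used to correct it to \<open>c\<close>, which is then the pivot that clears all
  other entries. Hence two indices and \<open>c\<close> nonzero are required.\<close>

lemma transv_unit:
  assumes "finite S" "k \<in> S" "k' \<in> S" "k \<noteq> k'" "i \<in> S" "u i \<noteq> 0" "c \<noteq> 0"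
  shows "\<exists>v'. transv S u v (\<lambda>j. if j = k then c else if j \<in> S then 0 else u j) v'"
proof -
  obtain u1 v1 m where 1: "transv S u v u1 v1" and m: "m \<in> S" "m \<noteq> k" "u1 m \<noteq> 0"
  proof (cases "i = k")
    case False
    with assms show ?thesis by (intro that[of u v i] transv.refl)
  next
    case True
    \<comment> \<open>The known nonzero entry is the one at \<open>k\<close> itself; this
      coefficient produces the entry 1 at \<open>k'\<close>.\<close>
    let ?a = "(u k' - 1) / u k"
    have "transv S u v (u(k' := u k' - ?a * u k)) (v(k := v k + ?a * v k'))"
      using assms by (intro transv_step) auto
    moreover have "(u(k' := u k' - ?a * u k)) k' \<noteq> 0" using assms True by simp
    ultimately show ?thesis by (intro that[OF _ assms(3) assms(4)[symmetric]])
  qed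
  \<comment> \<open>Solves u1_k - a u1_m = c for a.\<close>
  let ?a = "(u1 k - c) / u1 m"
  let ?u2 = "u1(k := u1 k - ?a * u1 m)" and ?v2 = "v1(m := v1 m + ?a * v1 k)"
  have 2: "transv S u v ?u2 ?v2"
    using assms m by (intro transv.step[OF 1]) auto
  have c: "?u2 k = c" using m by simp
  obtain v3 where 3: "transv S ?u2 ?v2 (\<lambda>i. if i \<in> S - {k} then 0 else ?u2 i) v3"
    using transv_clear[of "S - {k}" S k ?u2 ?v2] assms unfolding c by blast
  have "(\<lambda>i. if i \<in> S - {k} then 0 else ?u2 i) = (\<lambda>j. if j = k then c else if j \<in> S then 0 else u j)"
    using c transv_outside[OF 2] by fastforce
  with transv_trans[OF 2 3] show ?thesis by auto
qed

text \<open>The targets \<open>b\<close> and \<open>c\<close> are free nonzero scalars so that the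
  signs of the root vectors can be inserted later. With a third index the last scalar
  \<open>d\<close> of the fourth case can be moved to \<open>c\<close>; on two indices it remains as
  a parameter.\<close>

lemma transv_normal_form:
  fixes u v :: "nat \<Rightarrow> 'k::field"
  defines "\<delta> \<equiv> \<lambda>i (c::'k) (k::nat). if k = i then c else 0"
  assumes "p \<in> S" "q \<in> S" "p \<noteq> q" "finite S" "b \<noteq> 0" "c \<noteq> 0"
    "\<forall>k. k \<notin> S \<longrightarrow> u k = 0 \<and> v k = 0"
  obtains "u = (\<lambda>_. 0)" "v = (\<lambda>_. 0)"
  | "transv S u v (\<delta> p b) (\<lambda>_. 0)"
  | "transv S u v (\<lambda>_. 0) (\<delta> q c)"
  | d where "transv S u v (\<delta> p b) (\<delta> q d)" "d \<noteq> 0" "(\<exists>r\<in>S. r \<noteq> p \<and> r \<noteq> q) \<Longrightarrow> d = c"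
  | d where "transv S u v (\<delta> p b) (\<delta> p d)" "d \<noteq> 0"
proof -
  have u: "u = (\<lambda>_. 0)" if "\<forall>i\<in>S. u i = 0" using that assms(8) by fast
  have v: "v = (\<lambda>_. 0)" if "\<forall>i\<in>S. v i = 0" using that assms(8) by fast
  have unit: "(\<lambda>j. if j = k then c else if j \<in> S then 0 else w j) = \<delta> k c"
    if "\<forall>j. j \<notin> S \<longrightarrow> w j = 0" for w c k
    using that unfolding \<delta>_def by auto
  show ?thesis
  proof (cases "\<forall>i\<in>S. u i = 0")
    case u0: True
    show ?thesis
    proof (cases "\<forall>i\<in>S. v i = 0")
      case True
      with u0 u v show ?thesis by (intro that(1))
    next
      case False
      then obtain i where "i \<in> S" "v i \<noteq> 0" by auto
      with transv_unit[of S q p i v c u] obtain u'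
        where tr: "transv S v u (\<delta> q c) u'" using assms unit[of v] by auto
      have "u' = (\<lambda>_. 0)" using transv_zero[OF transv_swap[OF tr] u0] u[OF u0] by simp
      with transv_swap[OF tr] show ?thesis by (intro that(3)) simp
    qed
  next
    case False
    \<comment> \<open>The row is normalised first; what remains is to simplify the column without
      disturbing it.\<close>
    then obtain i where "i \<in> S" "u i \<noteq> 0" by auto
    with transv_unit[of S p q i u b v] obtain v'
      where tr: "transv S u v (\<delta> p b) v'" using assms unit[of u] by auto
    have v'0: "v' k = 0" if "k \<notin> S" for k using transv_outside[OF tr that] assms(8) that by simp
    show ?thesis
    proof (cases "\<forall>i\<in>S. v i = 0")
      case True
      have "v' = (\<lambda>_. 0)" using transv_zero[OF transv_swap[OF tr] True] v[OF True] by simp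
      with tr show ?thesis by (intro that(2)) simp
    next
      case False
      then obtain m where m: "m \<in> S" "v' m \<noteq> 0" using transv_zero_iff(2)[OF tr] by auto
      show ?thesis
      proof (cases "v' p = 0")
        case False
        \<comment> \<open>The column has a pivot at \<open>p\<close>, and clearing its other entries
          can change the row at \<open>p\<close> only.\<close>
        obtain u'' where tr2: "transv S v' (\<delta> p b) (\<lambda>i. if i \<in> S - {p} then 0 else v' i) u''"
          and u'': "\<forall>i. i \<noteq> p \<longrightarrow> u'' i = \<delta> p b i"
          using transv_clear[of "S - {p}" S p v' "\<delta> p b"] assms False by auto
        have v2: "(\<lambda>i. if i \<in> S - {p} then 0 else v' i) = \<delta> p (v' p)"
          using v'0 unfolding \<delta>_def by auto
        have eq: "transv S (\<delta> p b) v' u'' (\<delta> p (v' p))"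
          using transv_swap[OF tr2] unfolding v2 .
        \<comment> \<open>Invariance of the scalar product fixes the one entry of the row that could
          have changed.\<close>
        have "u'' p * v' p = b * v' p"
          using transv_dot[OF eq \<open>finite S\<close>] \<open>p \<in> S\<close> \<open>finite S\<close> unfolding \<delta>_def
          by (simp add: if_distrib[of "\<lambda>x. x * _"] if_distrib[of "\<lambda>x. _ * x"] sum.delta cong: if_cong)
        with False u'' have "u'' = \<delta> p b" unfolding \<delta>_def by fastforce
        with transv_trans[OF tr eq] False show ?thesis by (intro that(5)) auto
      next
        case True
        with m have "m \<noteq> p" by auto
        \<comment> \<open>The row vanishes on \<open>S - {p}\<close>, so steps over these indices
          lie in its stabilizer. They act on the rest of the column, where \<open>q\<close> and a
          third index suffice for \<open>transv_unit\<close>.\<close>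
        have z: "\<forall>i\<in>S - {p}. \<delta> p b i = 0" unfolding \<delta>_def by auto
        show ?thesis
        proof (cases "\<exists>r\<in>S. r \<noteq> p \<and> r \<noteq> q")
          case True
          then obtain r where r: "r \<in> S" "r \<noteq> p" "r \<noteq> q" by auto
          obtain u'' where tr2: "transv (S - {p}) v' (\<delta> p b)
              (\<lambda>j. if j = q then c else if j \<in> S - {p} then 0 else v' j) u''"
            using transv_unit[of "S - {p}" q r m v' c "\<delta> p b"] assms r m \<open>m \<noteq> p\<close> by auto
          have v2: "(\<lambda>j. if j = q then c else if j \<in> S - {p} then 0 else v' j) = \<delta> q c"
            using v'0 \<open>v' p = 0\<close> unfolding \<delta>_def by fastforce
          have "u'' = \<delta> p b" using transv_zero[OF transv_swap[OF tr2] z] .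
          with tr2 v2 have "transv (S - {p}) (\<delta> p b) v' (\<delta> p b) (\<delta> q c)"
            by (metis transv_swap)
          then have "transv S (\<delta> p b) v' (\<delta> p b) (\<delta> q c)" by (rule transv_mono) auto
          from transv_trans[OF tr this] \<open>c \<noteq> 0\<close> show ?thesis by (intro that(4)) auto
        next
          case False
          \<comment> \<open>Here \<open>S\<close> consists of \<open>p\<close> and \<open>q\<close>,
            so the column is already concentrated at \<open>q\<close>.\<close>
          then have "v' = \<delta> q (v' q)" using v'0 \<open>v' p = 0\<close> unfolding \<delta>_def by fastforce
          moreover have "v' q \<noteq> 0" using False m \<open>m \<noteq> p\<close> by auto
          ultimately show ?thesis using tr False by (intro that(4)[of "v' q"]) auto
        qed
      qed
    qed
  qed
qed

section \<open>Roots and root vectors\<close>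

abbreviation eps_diff :: "nat \<Rightarrow> nat \<Rightarrow> nat \<Rightarrow> int vec" where
  "eps_diff l i j \<equiv> unit_vec (Suc l) i - unit_vec (Suc l) j"

lemma eps_diff_scalar_prod:
  assumes "i < Suc l" "j < Suc l" "p < Suc l" "q < Suc l"
  shows "eps_diff l i j \<bullet> eps_diff l p q =
    of_bool (i = p) - of_bool (i = q) - of_bool (j = p) + of_bool (j = q)"
  using assms
  by (simp add: minus_scalar_prod_distrib[of _ "Suc l"] scalar_prod_left_unit root_index
      del: index_minus_vec)

text \<open>The sum of the simple roots telescopes in every coordinate.\<close>

lemma max_root_eq:
  assumes "l \<ge> 1"
  shows "max_root l = eps_diff l 0 l"
proof (rule eq_vecI)
  have car: "simple_root l \<in> {1..l} \<rightarrow> carrier_vec (Suc l)" by (simp add: simple_root_def)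
  then have "max_root l \<in> carrier_vec (Suc l)" unfolding max_root_def by (rule finsum_vec_closed)
  then show "dim_vec (max_root l) = dim_vec (eps_diff l 0 l)" by simp
  fix k assume "k < dim_vec (eps_diff l 0 l)"
  then have k: "k < Suc l" by simp
  have "max_root l $ k = (\<Sum>t=1..l. simple_root l t $ k)"
    unfolding max_root_def by (rule index_finsum_vec[OF _ k car]) simp
  also have "\<dots> = (\<Sum>t=1..l. of_bool (k = t - 1) - of_bool (k = t))"
    unfolding simple_root_def root_index[OF k] ..
  \<comment> \<open>Simple roots are numbered from 1 and coordinates from 0, hence the shift before
    telescoping.\<close>
  also have "\<dots> = (\<Sum>t<l. of_bool (k = t) - of_bool (k = Suc t))"
    by (rule sum.reindex_bij_witness[of _ Suc "\<lambda>t. t - 1"]) auto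
  also have "\<dots> = of_bool (k = 0) - of_bool (k = l)"
    by (rule sum_lessThan_telescope')
  finally show "max_root l $ k = eps_diff l 0 l $ k" unfolding root_index[OF k] .
qed

lemma rootsE:
  assumes "\<alpha> \<in> roots l"
  obtains i j where "\<alpha> = eps_diff l i j" "i < Suc l" "j < Suc l" "i \<noteq> j"
  using assms by (auto simp: roots_def)

lemma rootsI: "i < Suc l \<Longrightarrow> j < Suc l \<Longrightarrow> i \<noteq> j \<Longrightarrow> eps_diff l i j \<in> roots l"
  by (auto simp: roots_def)

text \<open>For distinct indices the contributions of 0 and \<open>l\<close> to the scalar product
  never cancel, so orthogonality means that neither of them occurs.\<close>

lemma Phi0_eq:
  assumes "l \<ge> 1"
  shows "Phi0 l = {eps_diff l i j | i j. i \<in> {1..<l} \<and> j \<in> {1..<l} \<and> i \<noteq> j}"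
proof -
  have "eps_diff l i j \<bullet> max_root l = 0 \<longleftrightarrow> i \<in> {1..<l} \<and> j \<in> {1..<l}"
    if "i < Suc l" "j < Suc l" "i \<noteq> j" for i j
    unfolding max_root_eq[OF assms] using that assms by (subst eps_diff_scalar_prod) auto
  then show ?thesis unfolding Phi0_def roots_def by fastforce
qed

text \<open>Every root has square length 2, so the cosine is half the scalar product, and
  \<open>arccos\<close> is injective on [-1, 1].\<close>

lemma root_angle_max_root:
  assumes "l \<ge> 1" "i < Suc l" "j < Suc l" "i \<noteq> j"
  shows "root_angle (eps_diff l i j) (max_root l) = pi / 3 \<longleftrightarrow> eps_diff l i j \<bullet> max_root l = 1"
proof -
  let ?x = "eps_diff l i j \<bullet> max_root l"
  have x: "?x = of_bool (i = 0) - of_bool (i = l) - of_bool (j = 0) + of_bool (j = l)"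
    unfolding max_root_eq[OF assms(1)] using assms by (subst eps_diff_scalar_prod) auto
  then have bounds: "- 2 \<le> ?x" "?x \<le> 2" using assms by auto
  have n: "eps_diff l i j \<bullet> eps_diff l i j = 2" "max_root l \<bullet> max_root l = 2"
    unfolding max_root_eq[OF assms(1)] using assms by (subst eps_diff_scalar_prod; simp)+
  have "root_angle (eps_diff l i j) (max_root l) = arccos (of_int ?x / 2)"
    unfolding root_angle_def n by simp
  moreover have "pi / 3 = arccos (1 / 2)"
    by (rule arccos_unique[symmetric]) (use cos_60 in auto)
  moreover have "arccos (of_int ?x / 2) = arccos (1 / 2) \<longleftrightarrow> of_int ?x / 2 = (1 / 2 :: real)"
    using bounds by (intro arccos_eq_iff) (auto simp: abs_le_iff)
  ultimately show ?thesis by simp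
qed

lemma Phi1_eq:
  assumes "l \<ge> 1"
  shows "Phi1 l = eps_diff l 0 ` {1..<l} \<union> (\<lambda>i. eps_diff l i l) ` {1..<l}"
proof -
  have "root_angle (eps_diff l i j) (max_root l) = pi / 3 \<longleftrightarrow>
      i = 0 \<and> j \<in> {1..<l} \<or> i \<in> {1..<l} \<and> j = l"
    if "i < Suc l" "j < Suc l" "i \<noteq> j" for i j
    unfolding root_angle_max_root[OF assms that]
    unfolding max_root_eq[OF assms] using that assms by (subst eps_diff_scalar_prod) auto
  then show ?thesis unfolding Phi1_def roots_def by (fastforce simp: image_iff)
qed

section \<open>Root vectors as signed matrix units\<close>

lemma entry_lie_bracket_cartan_elt:
  assumes "A \<in> carrier_mat (Suc l) (Suc l)" "p < Suc l" "q < Suc l"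
  shows "lie_bracket (cartan_elt l \<alpha>) A $$ (p, q) = (\<alpha> $ p - \<alpha> $ q) * A $$ (p, q)"
  unfolding lie_bracket_def cartan_elt_def
  using assms by (simp add: mat_diag_mult_left[of _ "Suc l" "Suc l"] mat_diag_mult_right[of _ "Suc l" "Suc l"] algebra_simps)

text \<open>The difference of the weights of the positions (p, q) and (i, j) is orthogonal to all
  simple roots, hence has constant coordinates. Their sum is 0, so the difference vanishes. The case
  p = q, of weight 0, is thereby excluded too.\<close>

lemma eq_of_simple_root_coords:
  assumes ij: "i < Suc l" "j < Suc l" "i \<noteq> j" and pq: "p < Suc l" "q < Suc l"
    and eq: "\<And>t. t \<in> {1..l} \<Longrightarrow>
      simple_root l t $ p - simple_root l t $ q = eps_diff l i j \<bullet> simple_root l t"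
  shows "p = i \<and> q = j"
proof -
  \<comment> \<open>The coordinates of (eps_p - eps_q) - (eps_i - eps_j).\<close>
  define x :: "nat \<Rightarrow> int" where
    "x k = of_bool (p = k) - of_bool (q = k) - of_bool (i = k) + of_bool (j = k)" for k
  have step: "x t = x (Suc t)" if "t < l" for t
  proof -
    have "simple_root l (Suc t) $ p - simple_root l (Suc t) $ q = eps_diff l i j \<bullet> eps_diff l t (Suc t)"
      using eq[of "Suc t"] that by (simp add: simple_root_def)
    also have "\<dots> = of_bool (i = t) - of_bool (i = Suc t) - of_bool (j = t) + of_bool (j = Suc t)"
      using that ij by (intro eps_diff_scalar_prod) auto
    finally show ?thesis
      unfolding simple_root_def root_index[OF pq(1)] root_index[OF pq(2)] x_def diff_Suc_1
      by (simp only: algebra_simps)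
  qed
  have const: "x k = x 0" if "k \<le> l" for k
    using that by (induction k) (auto simp: step[symmetric])
  have "(\<Sum>k\<le>l. x k) = 0"
    unfolding x_def sum.distrib sum_subtractf using ij pq
    by (simp add: of_bool_def less_Suc_eq_le)
  moreover have "(\<Sum>k\<le>l. x k) = (\<Sum>k\<le>l. x 0)" by (rule sum.cong[OF HOL.refl]) (rule const, simp)
  ultimately have "x 0 = 0" by simp
  then have "x i = 0" "x j = 0" using const[of i] const[of j] ij by linarith+
  with ij show ?thesis unfolding x_def by (auto simp: of_bool_def split: if_splits)
qed

text \<open>Each matrix position is a weight space of the Cartan subalgebra. Comparing entries in
  the eigenvector equation and cancelling the nonzero entry identifies its weight with the
  root.\<close>

lemma chevalley_basis_entry:
  assumes "chevalley_basis l e" and ij: "i < Suc l" "j < Suc l" "i \<noteq> j"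
    and pq: "p < Suc l" "q < Suc l" and "e (eps_diff l i j) $$ (p, q) \<noteq> 0"
  shows "p = i \<and> q = j"
proof (rule eq_of_simple_root_coords[OF ij pq])
  fix t assume t: "t \<in> {1..l}"
  let ?A = "e (eps_diff l i j)"
  from assms(1) rootsI[OF ij] t have A: "?A \<in> carrier_mat (Suc l) (Suc l)"
    and "lie_bracket (cartan_elt l (simple_root l t)) ?A = (eps_diff l i j \<bullet> simple_root l t) \<cdot>\<^sub>m ?A"
    unfolding chevalley_basis_def by blast+
  then have "(simple_root l t $ p - simple_root l t $ q) * ?A $$ (p, q)
      = ((eps_diff l i j \<bullet> simple_root l t) \<cdot>\<^sub>m ?A) $$ (p, q)"
    using entry_lie_bracket_cartan_elt[OF A pq, of "simple_root l t"] by simp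
  also have "\<dots> = (eps_diff l i j \<bullet> simple_root l t) * ?A $$ (p, q)" using A pq by simp
  finally show "simple_root l t $ p - simple_root l t $ q = eps_diff l i j \<bullet> simple_root l t"
    using assms(7) by simp
qed

text \<open>Compare the entries at (i, i) in [e_alpha, e_(-alpha)] = h_alpha: only one product
  survives. Both factors are thus units of the integers, that is, signs.\<close>

lemma chevalley_basis_coeff_mult:
  assumes e: "chevalley_basis l e" and ij: "i < Suc l" "j < Suc l" "i \<noteq> j"
  shows "e (eps_diff l i j) $$ (i, j) * e (eps_diff l j i) $$ (j, i) = 1"
proof -
  let ?A = "e (eps_diff l i j)" and ?B = "e (eps_diff l j i)"
  have neg: "- eps_diff l i j = eps_diff l j i" by auto
  from e rootsI[OF ij] rootsI[OF ij(2,1) ij(3)[symmetric]]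
  have A: "?A \<in> carrier_mat (Suc l) (Suc l)" and B: "?B \<in> carrier_mat (Suc l) (Suc l)"
    and AB: "lie_bracket ?A ?B = cartan_elt l (eps_diff l i j)"
    unfolding chevalley_basis_def neg[symmetric] by blast+
  have "lie_bracket ?A ?B $$ (i, i)
      = (\<Sum>k\<in>{0..<Suc l}. ?A $$ (i, k) * ?B $$ (k, i)) - (\<Sum>k\<in>{0..<Suc l}. ?B $$ (i, k) * ?A $$ (k, i))"
    unfolding lie_bracket_def using A B ij by (simp add: scalar_prod_def)
  also have "(\<Sum>k\<in>{0..<Suc l}. ?A $$ (i, k) * ?B $$ (k, i))
      = (\<Sum>k\<in>{0..<Suc l}. if k = j then ?A $$ (i, j) * ?B $$ (j, i) else 0)"
    using chevalley_basis_entry[OF e ij ij(1)] by (intro sum.cong) fastforce+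
  also have "\<dots> = ?A $$ (i, j) * ?B $$ (j, i)" using ij by simp
  also have "(\<Sum>k\<in>{0..<Suc l}. ?B $$ (i, k) * ?A $$ (k, i)) = 0"
    using chevalley_basis_entry[OF e ij _ ij(1)] ij by (intro sum.neutral) fastforce
  finally have "lie_bracket ?A ?B $$ (i, i) = ?A $$ (i, j) * ?B $$ (j, i)" by simp
  moreover have "cartan_elt l (eps_diff l i j) $$ (i, i) = 1"
    using ij root_index[of i "Suc l" i j] by (simp add: cartan_elt_def mat_diag_def)
  ultimately show ?thesis using AB by simp
qed

text \<open>The sign that the Chevalley relations leave open, read in the field. It is carried along
  as a nonzero scalar and absorbed into the normal forms.\<close>

definition root_coeff :: "nat \<Rightarrow> (int vec \<Rightarrow> int mat) \<Rightarrow> nat \<Rightarrow> nat \<Rightarrow> 'k::field" where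
  "root_coeff l e i j = of_int (e (eps_diff l i j) $$ (i, j))"

lemma root_coeff_nonzero:
  assumes "chevalley_basis l e" "i < Suc l" "j < Suc l" "i \<noteq> j"
  shows "root_coeff l e i j \<noteq> (0 :: 'k::field)"
proof
  assume "root_coeff l e i j = (0 :: 'k)"
  then have "of_int (e (eps_diff l i j) $$ (i, j) * e (eps_diff l j i) $$ (j, i)) = (0 :: 'k)"
    by (simp add: root_coeff_def)
  with chevalley_basis_coeff_mult[OF assms] show False by simp
qed

lemma root_vector_eq:
  assumes e: "chevalley_basis l e" and ij: "i < Suc l" "j < Suc l" "i \<noteq> j"
  shows "root_vector e (eps_diff l i j) =
    mat (Suc l) (Suc l) (\<lambda>x. if x = (i, j) then root_coeff l e i j else 0)"
proof -
  have "e (eps_diff l i j) \<in> carrier_mat (Suc l) (Suc l)"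
    using e rootsI[OF ij] unfolding chevalley_basis_def by blast
  moreover have "e (eps_diff l i j) $$ (p, q) = 0" if "p < Suc l" "q < Suc l" "(p, q) \<noteq> (i, j)" for p q
    using chevalley_basis_entry[OF e ij that(1,2)] that(3) by auto
  ultimately show ?thesis
    unfolding root_vector_def root_coeff_def by (intro eq_matI) auto
qed

text \<open>Turns root elements into elementary matrices, so that multiplying by them becomes a row
  or column operation.\<close>

lemma root_elt_eq:
  assumes e: "chevalley_basis l e" and ij: "i < Suc l" "j < Suc l" "i \<noteq> j"
  shows "root_elt l e (eps_diff l i j) a = addrow_mat (Suc l) (a * root_coeff l e i j) i j"
  unfolding root_elt_def root_vector_eq[OF assms] using ij by (intro eq_matI) auto

section \<open>The action of \<open>G\<^sub>0\<close> on \<open>V\<^sub>1\<close>\<close>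

text \<open>Row and column are functions on all naturals, of which only the values on
  \<open>{1..<l}\<close> enter the matrix.\<close>

definition V1_mat :: "nat \<Rightarrow> (nat \<Rightarrow> 'k::field) \<Rightarrow> (nat \<Rightarrow> 'k) \<Rightarrow> 'k mat" where
  "V1_mat l u v = mat (Suc l) (Suc l)
     (\<lambda>(p, q). if p = 0 \<and> q \<in> {1..<l} then u q else if q = l \<and> p \<in> {1..<l} then v p else 0)"

lemma V1_mat_carrier [simp]: "V1_mat l u v \<in> carrier_mat (Suc l) (Suc l)"
  by (simp add: V1_mat_def)

lemma V1_mat_eq_iff:
  "V1_mat l u v = V1_mat l u' v' \<longleftrightarrow> (\<forall>i\<in>{1..<l}. u i = u' i \<and> v i = v' i)"
proof
  assume eq: "V1_mat l u v = V1_mat l u' v'"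
  show "\<forall>i\<in>{1..<l}. u i = u' i \<and> v i = v' i"
  proof
    fix i assume "i \<in> {1..<l}"
    then show "u i = u' i \<and> v i = v' i"
      using arg_cong[OF eq, of "\<lambda>A. A $$ (0, i)"] arg_cong[OF eq, of "\<lambda>A. A $$ (i, l)"]
      by (simp add: V1_mat_def)
  qed
qed (auto simp: V1_mat_def intro!: eq_matI)

lemma V1_mat_zero: "V1_mat l (\<lambda>_. 0) (\<lambda>_. 0) = 0\<^sub>m (Suc l) (Suc l)"
  by (rule eq_matI) (auto simp: V1_mat_def)

lemma V1_mat_add:
  "V1_mat l u v + V1_mat l u' v' = V1_mat l (\<lambda>i. u i + u' i) (\<lambda>i. v i + v' i)"
  by (rule eq_matI) (auto simp: V1_mat_def)

lemma V1_mat_smult: "a \<cdot>\<^sub>m V1_mat l u v = V1_mat l (\<lambda>i. a * u i) (\<lambda>i. a * v i)"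
  by (rule eq_matI) (auto simp: V1_mat_def)

lemma root_vector_row:
  assumes "chevalley_basis l e" "j \<in> {1..<l}"
  shows "root_vector e (eps_diff l 0 j) = V1_mat l (\<lambda>k. if k = j then root_coeff l e 0 j else 0) (\<lambda>_. 0)"
  using assms by (subst root_vector_eq) (auto simp: V1_mat_def intro!: eq_matI)

lemma root_vector_col:
  assumes "chevalley_basis l e" "i \<in> {1..<l}"
  shows "root_vector e (eps_diff l i l) = V1_mat l (\<lambda>_. 0) (\<lambda>k. if k = i then root_coeff l e i l else 0)"
  using assms by (subst root_vector_eq) (auto simp: V1_mat_def intro!: eq_matI)

text \<open>The matrices \<open>V1_mat l u v\<close> form a submodule containing the generators.
  Conversely, each is assembled entry by entry from root vectors, dividing by the nonzero root
  coefficients.\<close>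

lemma V1_eq:
  assumes e: "chevalley_basis l e" and l: "l \<ge> 1"
  shows "(V1 l e :: 'k::field mat set) = {V1_mat l u v | u v. True}"
proof -
  interpret vectorspace "class_ring :: 'k ring" "module_mat TYPE('k) (Suc l) (Suc l)"
    by (rule matrix_vs)
  let ?X = "root_vector e ` Phi1 l :: 'k mat set"
  have X: "?X \<subseteq> {V1_mat l u v | u v. True}"
    unfolding Phi1_eq[OF l] using root_vector_row[OF e] root_vector_col[OF e] by fastforce
  have Xc: "?X \<subseteq> carrier (module_mat TYPE('k) (Suc l) (Suc l))"
    using X by (auto simp: module_mat_simps)
  have "LinearCombinations.submodule class_ring {V1_mat l u v | u v. True}
      (module_mat TYPE('k) (Suc l) (Suc l))"
  proof (unfold_locales, unfold module_mat_simps)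
    show "0\<^sub>m (Suc l) (Suc l) \<in> {V1_mat l u v | u v. True}"
      using V1_mat_zero[of l, symmetric] by blast
  qed (auto simp: V1_mat_add V1_mat_smult, blast+)
  then have le: "(V1 l e :: 'k mat set) \<subseteq> {V1_mat l u v | u v. True}"
    unfolding V1_def using X by (intro span_is_subset)
  have sub: "LinearCombinations.submodule class_ring (V1 l e :: 'k mat set)
      (module_mat TYPE('k) (Suc l) (Suc l))"
    unfolding V1_def by (rule span_is_submodule[OF Xc])
  note sub = sub[unfolded LinearCombinations.submodule_def module_mat_simps class_ring_simps]
  have zero: "0\<^sub>m (Suc l) (Suc l) \<in> (V1 l e :: 'k mat set)" using sub by simp
  have add: "A + B \<in> V1 l e" if "A \<in> V1 l e" "B \<in> V1 l e" for A B :: "'k mat"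
    using sub that by simp
  have smult: "a \<cdot>\<^sub>m A \<in> V1 l e" if "A \<in> V1 l e" for a and A :: "'k mat"
    using sub that by simp
  have root: "root_vector e \<alpha> \<in> (V1 l e :: 'k mat set)" if "\<alpha> \<in> Phi1 l" for \<alpha>
    unfolding V1_def using in_own_span[OF Xc] that by blast
  have row: "V1_mat l (\<lambda>k. if k \<in> T then u k else 0) (\<lambda>_. 0) \<in> V1 l e"
    if "finite T" "T \<subseteq> {1..<l}" for u :: "nat \<Rightarrow> 'k" and T
    using that
  proof (induction T)
    case empty
    then show ?case using zero by (simp add: V1_mat_zero)
  next
    case (insert j T)
    let ?c = "root_coeff l e 0 j :: 'k"
    have c: "?c \<noteq> 0" using insert.prems by (intro root_coeff_nonzero[OF e]) auto
    have "eps_diff l 0 j \<in> Phi1 l" unfolding Phi1_eq[OF l] using insert.prems by auto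
    then have "V1_mat l (\<lambda>k. if k \<in> T then u k else 0) (\<lambda>_. 0)
        + (u j / ?c) \<cdot>\<^sub>m root_vector e (eps_diff l 0 j) \<in> V1 l e"
      using insert by (intro add smult root) auto
    also have "V1_mat l (\<lambda>k. if k \<in> T then u k else 0) (\<lambda>_. 0)
        + (u j / ?c) \<cdot>\<^sub>m root_vector e (eps_diff l 0 j)
        = V1_mat l (\<lambda>k. if k \<in> insert j T then u k else 0) (\<lambda>_. 0)"
      using insert c
      by (auto simp: root_vector_row[OF e] V1_mat_smult V1_mat_add V1_mat_eq_iff)
    finally show ?case .
  qed
  have col: "V1_mat l (\<lambda>_. 0) (\<lambda>k. if k \<in> T then v k else 0) \<in> V1 l e"
    if "finite T" "T \<subseteq> {1..<l}" for v :: "nat \<Rightarrow> 'k" and T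
    using that
  proof (induction T)
    case empty
    then show ?case using zero by (simp add: V1_mat_zero)
  next
    case (insert j T)
    let ?c = "root_coeff l e j l :: 'k"
    have c: "?c \<noteq> 0" using insert.prems by (intro root_coeff_nonzero[OF e]) auto
    have "eps_diff l j l \<in> Phi1 l" unfolding Phi1_eq[OF l] using insert.prems by auto
    then have "V1_mat l (\<lambda>_. 0) (\<lambda>k. if k \<in> T then v k else 0)
        + (v j / ?c) \<cdot>\<^sub>m root_vector e (eps_diff l j l) \<in> V1 l e"
      using insert by (intro add smult root) auto
    also have "V1_mat l (\<lambda>_. 0) (\<lambda>k. if k \<in> T then v k else 0)
        + (v j / ?c) \<cdot>\<^sub>m root_vector e (eps_diff l j l)
        = V1_mat l (\<lambda>_. 0) (\<lambda>k. if k \<in> insert j T then v k else 0)"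
      using insert c
      by (auto simp: root_vector_col[OF e] V1_mat_smult V1_mat_add V1_mat_eq_iff)
    finally show ?case .
  qed
  have "V1_mat l u v \<in> V1 l e" for u v :: "nat \<Rightarrow> 'k"
  proof -
    have "V1_mat l u v = V1_mat l (\<lambda>k. if k \<in> {1..<l} then u k else 0) (\<lambda>_. 0)
        + V1_mat l (\<lambda>_. 0) (\<lambda>k. if k \<in> {1..<l} then v k else 0)"
      unfolding V1_mat_add V1_mat_eq_iff by simp
    also have "\<dots> \<in> V1 l e" by (intro add row col) auto
    finally show ?thesis .
  qed
  with le show ?thesis by auto
qed

lemma V1_mat_in_V1: "chevalley_basis l e \<Longrightarrow> l \<ge> 1 \<Longrightarrow> V1_mat l u v \<in> V1 l e"
  by (auto simp: V1_eq)

lemma V1_subset_lie_algebra: "(V1 l e :: 'k::field mat set) \<subseteq> lie_algebra l e"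
proof -
  interpret vectorspace "class_ring :: 'k ring" "module_mat TYPE('k) (Suc l) (Suc l)"
    by (rule matrix_vs)
  show ?thesis unfolding V1_def lie_algebra_def
    by (rule span_is_monotone) (auto simp: Phi1_def)
qed

section \<open>The groups inside GL and their action by conjugation\<close>

lemma group_GL: "group (GL n :: 'k::field mat monoid)"
proof -
  interpret ring "ring_mat TYPE('k) n ()" by (rule ring_mat)
  show ?thesis unfolding GL_def by (rule units_group)
qed

lemma GL_simps:
  "carrier (GL n) = Units (ring_mat TYPE('k::field) n ())"
  "mult (GL n) = ((*) :: 'k mat \<Rightarrow> _)"
  "one (GL n) = (1\<^sub>m n :: 'k mat)"
  by (simp_all add: GL_def units_of_def ring_mat_simps)

lemma GL_carrier_mat:
  "g \<in> carrier (GL n) \<Longrightarrow> g \<in> carrier_mat n n"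
  by (simp add: GL_simps Units_def ring_mat_simps)

lemma inv_GL_addrow_mat:
  assumes "i < n" "j < n" "i \<noteq> j"
  shows "inv\<^bsub>GL n\<^esub> (addrow_mat n a i j) = addrow_mat n (- a :: 'k::field) i j"
  using addrow_mat_Unit[OF assms] addrow_mat_inv[OF assms, of "- a"]
  by (intro group.inv_equality[OF group_GL]) (simp_all add: GL_simps)

lemma root_elt_in_GL:
  assumes e: "chevalley_basis l e" and "\<alpha> \<in> roots l"
  shows "root_elt l e \<alpha> a \<in> carrier (GL (Suc l))"
  using assms(2) by (elim rootsE) (simp add: root_elt_eq[OF e] GL_simps addrow_mat_Unit)

text \<open>\<open>G0\<close> is generated inside \<open>chevalley_group\<close>, but generation in
  a subgroup agrees with generation in the whole group, so \<open>G0\<close> can be treated inside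
  GL.\<close>

lemma
  assumes e: "chevalley_basis l e"
  shows subgroup_chevalley_group:
      "subgroup (carrier (chevalley_group l e :: 'k::field mat monoid)) (GL (Suc l))"
    and carrier_G0: "carrier (G0 l e :: 'k mat monoid) =
      generate (GL (Suc l)) {root_elt l e \<alpha> a | \<alpha> a. \<alpha> \<in> Phi0 l}"
    and G0_subset_chevalley_group:
      "carrier (G0 l e :: 'k mat monoid) \<subseteq> carrier (chevalley_group l e)"
proof -
  interpret GL: group "GL (Suc l) :: 'k mat monoid" by (rule group_GL)
  let ?X = "{root_elt l e \<alpha> a | \<alpha> a. \<alpha> \<in> roots l} :: 'k mat set"
  let ?Y = "{root_elt l e \<alpha> a | \<alpha> a. \<alpha> \<in> Phi0 l} :: 'k mat set"
  have X: "?X \<subseteq> carrier (GL (Suc l))" by (auto intro: root_elt_in_GL[OF e])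
  have X0: "?Y \<subseteq> ?X" by (auto simp: Phi0_def)
  have sub: "subgroup (generate (GL (Suc l)) ?X) (GL (Suc l))"
    by (rule GL.generate_is_subgroup[OF X])
  then show "subgroup (carrier (chevalley_group l e :: 'k mat monoid)) (GL (Suc l))"
    by (simp add: chevalley_group_def)
  have "?Y \<subseteq> generate (GL (Suc l)) ?X" using X0 by (meson generate.incl subset_iff)
  from GL.generate_consistent[OF this sub]
  show G0: "carrier (G0 l e :: 'k mat monoid) = generate (GL (Suc l)) ?Y"
    by (simp add: G0_def chevalley_group_def)
  show "carrier (G0 l e :: 'k mat monoid) \<subseteq> carrier (chevalley_group l e)"
    unfolding G0 using GL.mono_generate[OF X0] by (simp add: chevalley_group_def)
qed

text \<open>Inverses in the subgroup are those of GL, and \<open>V1\<close> lies in the Lie algebra,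
  so both restrictions disappear on \<open>V1\<close>.\<close>

lemma G0_action_eq:
  assumes "chevalley_basis l e" "g \<in> carrier (G0 l e)" "x \<in> V1 l e"
  shows "G0_action l e g x = g * x * inv\<^bsub>GL (Suc l)\<^esub> (g :: 'k::field mat)"
proof -
  have g: "g \<in> carrier (chevalley_group l e)"
    using assms G0_subset_chevalley_group by blast
  have "chevalley_group l e = (GL (Suc l))\<lparr>carrier := carrier (chevalley_group l e :: 'k mat monoid)\<rparr>"
    by (simp add: chevalley_group_def)
  then have "inv\<^bsub>chevalley_group l e\<^esub> g = inv\<^bsub>GL (Suc l)\<^esub> g"
    using group.m_inv_consistent[OF group_GL subgroup_chevalley_group[OF assms(1)] g] by simp
  then show ?thesis
    using assms(3) V1_subset_lie_algebra[of l e, where 'k = 'k]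
    by (auto simp: G0_action_def adjoint_action_def)
qed

text \<open>The left factor adds a times row \<open>i\<close>'s partner \<open>j\<close> to row
  \<open>i\<close>, where only the entries in column \<open>l\<close> matter; the right factor
  subtracts a times column \<open>i\<close> from column \<open>j\<close>, where only row 0
  matters.\<close>

lemma addrow_mat_conj_V1_mat:
  assumes "i \<in> {1..<l}" "j \<in> {1..<l}" "i \<noteq> j"
  shows "addrow_mat (Suc l) a i j * V1_mat l u v * addrow_mat (Suc l) (- a) i j =
    V1_mat l (u(j := u j - a * u i)) (v(i := v i + a * v j :: 'k::field))"
proof -
  have "addrow_mat (Suc l) a i j * V1_mat l u v = addrow a i j (V1_mat l u v)"
    using assms by (intro addrow_mat[symmetric, of _ _ "Suc l"]) auto
  moreover have "\<dots> * addrow_mat (Suc l) (- a) i j = addcol (- a) j i \<dots>"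
    using assms by (intro addcol_mat[symmetric, of _ "Suc l"]) auto
  moreover have "\<dots> = V1_mat l (u(j := u j - a * u i)) (v(i := v i + a * v j))"
    using assms by (intro eq_matI) (auto simp: V1_mat_def)
  ultimately show ?thesis by simp
qed

lemma G0_action_root_elt:
  assumes e: "chevalley_basis l e" and l: "l \<ge> 1"
    and ij: "i \<in> {1..<l}" "j \<in> {1..<l}" "i \<noteq> j"
  shows "root_elt l e (eps_diff l i j) a \<in> carrier (G0 l e)"
    and "inv\<^bsub>GL (Suc l)\<^esub> (root_elt l e (eps_diff l i j) a) = root_elt l e (eps_diff l i j) (- a)"
    and "G0_action l e (root_elt l e (eps_diff l i j) a) (V1_mat l u v) =
      V1_mat l (u(j := u j - a * root_coeff l e i j * u i)) (v(i := v i + a * root_coeff l e i j * (v j :: 'k::field)))"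
proof -
  have eq: "root_elt l e (eps_diff l i j) b = addrow_mat (Suc l) (b * root_coeff l e i j) i j" for b :: 'k
    using ij by (intro root_elt_eq[OF e]) auto
  show mem: "root_elt l e (eps_diff l i j) a \<in> carrier (G0 l e)"
    unfolding carrier_G0[OF e] Phi0_eq[OF l] using ij by (intro generate.incl) blast
  show inv: "inv\<^bsub>GL (Suc l)\<^esub> (root_elt l e (eps_diff l i j) a) = root_elt l e (eps_diff l i j) (- a)"
    unfolding eq using ij by (subst inv_GL_addrow_mat) auto
  show "G0_action l e (root_elt l e (eps_diff l i j) a) (V1_mat l u v) =
      V1_mat l (u(j := u j - a * root_coeff l e i j * u i)) (v(i := v i + a * root_coeff l e i j * v j))"
    unfolding G0_action_eq[OF e mem V1_mat_in_V1[OF e l]] inv unfolding eq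
    using addrow_mat_conj_V1_mat[OF ij, of "a * root_coeff l e i j" u v] by simp
qed

lemma G0_action_one:
  assumes e: "chevalley_basis l e" and l: "l \<ge> 1"
  shows "\<one>\<^bsub>GL (Suc l)\<^esub> \<in> carrier (G0 l e :: 'k::field mat monoid)"
    and "G0_action l e \<one>\<^bsub>GL (Suc l)\<^esub> (V1_mat l u v :: 'k mat) = V1_mat l u v"
proof -
  interpret GL: group "GL (Suc l) :: 'k mat monoid" by (rule group_GL)
  show mem: "\<one>\<^bsub>GL (Suc l)\<^esub> \<in> carrier (G0 l e :: 'k mat monoid)"
    unfolding carrier_G0[OF e] by (rule generate.one)
  have "G0_action l e \<one>\<^bsub>GL (Suc l)\<^esub> (V1_mat l u v) = 1\<^sub>m (Suc l) * V1_mat l u v * 1\<^sub>m (Suc l)"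
    unfolding G0_action_eq[OF e mem V1_mat_in_V1[OF e l]] GL.inv_one unfolding GL_simps ..
  also have "\<dots> = V1_mat l u v"
    by (simp add: left_mult_one_mat[of _ _ "Suc l"] right_mult_one_mat[of _ "Suc l"])
  finally show "G0_action l e \<one>\<^bsub>GL (Suc l)\<^esub> (V1_mat l u v) = V1_mat l u v" .
qed

text \<open>Applied with C and D the inverses of A and B, this says that conjugation by A B is
  conjugation by B followed by conjugation by A.\<close>

lemma mult_mat_reassoc:
  fixes A :: "'a::semiring_0 mat"
  assumes A: "A \<in> carrier_mat n n" and B: "B \<in> carrier_mat n n" and C: "C \<in> carrier_mat n n"
    and D: "D \<in> carrier_mat n n" and X: "X \<in> carrier_mat n n"
  shows "A * B * X * (D * C) = A * (B * X * D) * C"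
proof -
  note BX = mult_carrier_mat[OF B X]
  have "A * B * X * (D * C) = A * (B * X) * (D * C)" using assoc_mult_mat[OF A B X] by simp
  also have "\<dots> = A * (B * X) * D * C" using assoc_mult_mat[OF mult_carrier_mat[OF A BX] D C] by simp
  also have "\<dots> = A * (B * X * D) * C" using assoc_mult_mat[OF A BX D] by simp
  finally show ?thesis .
qed

text \<open>The hypothesis \<open>hx\<close> is met where the lemma is applied because the image
  under \<open>h\<close> is known there explicitly as a \<open>V1_mat\<close>.\<close>

lemma G0_action_mult:
  assumes e: "chevalley_basis l e" and l: "l \<ge> 1"
    and g: "g \<in> carrier (G0 l e)" and h: "h \<in> carrier (G0 l e)"
    and x: "x \<in> V1 l e" and hx: "G0_action l e h x \<in> V1 l e"
  shows "g * h \<in> carrier (G0 l e)"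
    and "G0_action l e (g * h) x = G0_action l e g (G0_action l e h (x :: 'k::field mat))"
proof -
  interpret GL: group "GL (Suc l) :: 'k mat monoid" by (rule group_GL)
  show gh: "g * h \<in> carrier (G0 l e)"
    using generate.eng[OF g[unfolded carrier_G0[OF e]] h[unfolded carrier_G0[OF e]]]
    unfolding carrier_G0[OF e] GL_simps .
  have sub: "carrier (G0 l e) \<subseteq> carrier (GL (Suc l) :: 'k mat monoid)"
    using G0_subset_chevalley_group[OF e] subgroup.subset[OF subgroup_chevalley_group[OF e]] by blast
  have gl: "g \<in> carrier (GL (Suc l))" "h \<in> carrier (GL (Suc l))" using g h sub by auto
  have inv: "inv\<^bsub>GL (Suc l)\<^esub> (g * h) = inv\<^bsub>GL (Suc l)\<^esub> h * inv\<^bsub>GL (Suc l)\<^esub> g"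
    using GL.inv_mult_group[OF gl] unfolding GL_simps .
  have "x \<in> carrier_mat (Suc l) (Suc l)" using x by (auto simp: V1_eq[OF e l])
  then have "g * h * x * (inv\<^bsub>GL (Suc l)\<^esub> h * inv\<^bsub>GL (Suc l)\<^esub> g)
      = g * (h * x * inv\<^bsub>GL (Suc l)\<^esub> h) * inv\<^bsub>GL (Suc l)\<^esub> g"
    using gl GL.inv_closed GL_carrier_mat by (intro mult_mat_reassoc) blast+
  then show "G0_action l e (g * h) x = G0_action l e g (G0_action l e h x)"
    unfolding G0_action_eq[OF e g hx] unfolding G0_action_eq[OF e gh x] G0_action_eq[OF e h x] inv .
qed

section \<open>Orbits of \<open>G0\<close> as classes of transvection chains\<close>

lemma transv_imp_G0_action:
  assumes e: "chevalley_basis l e" and l: "l \<ge> 1"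
    and "transv {1..<l} u v u' (v' :: nat \<Rightarrow> 'k::field)"
  shows "\<exists>g\<in>carrier (G0 l e). G0_action l e g (V1_mat l u v) = V1_mat l u' v'"
  using assms(3)
proof induction
  case (refl u v)
  show ?case using G0_action_one[OF e l] by blast
next
  case (step u v u' v' i j a)
  then obtain g where g: "g \<in> carrier (G0 l e)" "G0_action l e g (V1_mat l u v) = V1_mat l u' v'"
    by blast
  \<comment> \<open>Dividing by the root coefficient makes the step have coefficient exactly
    \<open>a\<close>.\<close>
  let ?h = "root_elt l e (eps_diff l i j) (a / root_coeff l e i j)"
  note h = G0_action_root_elt[OF e l step(2-4), of "a / root_coeff l e i j"]
  have mem: "G0_action l e g (V1_mat l u v) \<in> V1 l e"
    unfolding g(2) by (rule V1_mat_in_V1[OF e l])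
  note gh = G0_action_mult[OF e l h(1) g(1) V1_mat_in_V1[OF e l] mem]
  have "root_coeff l e i j \<noteq> (0 :: 'k)" using step by (intro root_coeff_nonzero[OF e]) auto
  then have "G0_action l e (?h * g) (V1_mat l u v) =
      V1_mat l (u'(j := u' j - a * u' i)) (v'(i := v' i + a * v' j))"
    unfolding gh(2) g(2) h(3) by simp
  with gh(1) show ?case by blast
qed

text \<open>Induction over generated elements. An inverse generator is the root element with
  parameter \<open>- a\<close>, hence again a step. Row and column are arbitrary because in a
  product the left factor acts on the image under the right one.\<close>

lemma G0_action_imp_transv:
  assumes e: "chevalley_basis l e" and l: "l \<ge> 1" and "g \<in> carrier (G0 l e)"
  shows "\<exists>u' v'. transv {1..<l} u v u' v' \<and>
    G0_action l e g (V1_mat l u v) = V1_mat l u' (v' :: nat \<Rightarrow> 'k::field)"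
  using assms(3)[unfolded carrier_G0[OF e]]
proof (induction arbitrary: u v)
  case one
  show ?case using G0_action_one[OF e l] transv.refl by blast
next
  case (incl h)
  then show ?case unfolding Phi0_eq[OF l] using G0_action_root_elt(3)[OF e l] transv_step by blast
next
  case (inv h)
  then obtain i j a where ij: "i \<in> {1..<l}" "j \<in> {1..<l}" "i \<noteq> j" "h = root_elt l e (eps_diff l i j) a"
    unfolding Phi0_eq[OF l] by blast
  then show ?case
    unfolding ij(4) G0_action_root_elt(2)[OF e l ij(1-3)]
    using G0_action_root_elt(3)[OF e l ij(1-3)] transv_step[OF ij(1-3)] by blast
next
  case (eng g h)
  obtain u1 v1 where 1: "transv {1..<l} u v u1 v1" "G0_action l e h (V1_mat l u v) = V1_mat l u1 v1"
    using eng.IH(2) by blast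
  obtain u2 v2 where 2: "transv {1..<l} u1 v1 u2 v2" "G0_action l e g (V1_mat l u1 v1) = V1_mat l u2 v2"
    using eng.IH(1) by blast
  have g: "g \<in> carrier (G0 l e)" and h: "h \<in> carrier (G0 l e)"
    using eng.hyps unfolding carrier_G0[OF e] .
  have mem: "G0_action l e h (V1_mat l u v) \<in> V1 l e"
    unfolding 1(2) by (rule V1_mat_in_V1[OF e l])
  have "G0_action l e (g * h) (V1_mat l u v) = V1_mat l u2 v2"
    unfolding G0_action_mult(2)[OF e l g h V1_mat_in_V1[OF e l] mem] 1(2) 2(2) ..
  then show ?case using transv_trans[OF 1(1) 2(1)] by (auto simp: GL_simps)
qed

lemma G0_orbit_V1_mat:
  assumes e: "chevalley_basis l e" and l: "l \<ge> 1"
  shows "G0_orbit l e (V1_mat l u v) = {V1_mat l u' v' | u' v'. transv {1..<l} u v u' (v' :: nat \<Rightarrow> 'k::field)}"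
proof
  show "G0_orbit l e (V1_mat l u v) \<subseteq> {V1_mat l u' v' | u' v'. transv {1..<l} u v u' v'}"
  proof
    fix y assume "y \<in> G0_orbit l e (V1_mat l u v)"
    then obtain g where g: "g \<in> carrier (G0 l e)" and y: "y = G0_action l e g (V1_mat l u v)"
      unfolding orbit_def by blast
    from G0_action_imp_transv[OF e l g, of u v]
    show "y \<in> {V1_mat l u' v' | u' v'. transv {1..<l} u v u' v'}" unfolding y by blast
  qed
  show "{V1_mat l u' v' | u' v'. transv {1..<l} u v u' v'} \<subseteq> G0_orbit l e (V1_mat l u v)"
  proof
    fix y assume "y \<in> {V1_mat l u' v' | u' v'. transv {1..<l} u v u' v'}"
    then obtain u' v' where y: "y = V1_mat l u' v'" and tr: "transv {1..<l} u v u' v'" by blast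
    obtain g where "g \<in> carrier (G0 l e)" "G0_action l e g (V1_mat l u v) = V1_mat l u' v'"
      using transv_imp_G0_action[OF e l tr] by blast
    then show "y \<in> G0_orbit l e (V1_mat l u v)" unfolding orbit_def y by force
  qed
qed

section \<open>Normal forms\<close>

lemma G0_orbit_eqE:
  assumes e: "chevalley_basis l e" and l: "l \<ge> 1"
    and "G0_orbit l e (V1_mat l u v) = G0_orbit l e (V1_mat l u' (v' :: nat \<Rightarrow> 'k::field))"
  obtains u'' v'' where "transv {1..<l} u v u'' v''"
    "\<And>i. i \<in> {1..<l} \<Longrightarrow> u'' i = u' i" "\<And>i. i \<in> {1..<l} \<Longrightarrow> v'' i = v' i"
proof -
  have "V1_mat l u' v' \<in> G0_orbit l e (V1_mat l u v)"
    unfolding assms(3) unfolding G0_orbit_V1_mat[OF e l] using transv.refl by blast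
  then show ?thesis
    unfolding G0_orbit_V1_mat[OF e l] using that by (auto simp: V1_mat_eq_iff)
qed

lemma G0_orbit_invariants:
  assumes e: "chevalley_basis l e" and l: "l \<ge> 1"
    and eq: "G0_orbit l e (V1_mat l u v) = G0_orbit l e (V1_mat l u' (v' :: nat \<Rightarrow> 'k::field))"
  shows "(\<forall>i\<in>{1..<l}. u i = 0) \<longleftrightarrow> (\<forall>i\<in>{1..<l}. u' i = 0)"
    and "(\<forall>i\<in>{1..<l}. v i = 0) \<longleftrightarrow> (\<forall>i\<in>{1..<l}. v' i = 0)"
    and "(\<Sum>i=1..<l. u i * v i) = (\<Sum>i=1..<l. u' i * v' i)"
proof -
  obtain u'' v'' where tr: "transv {1..<l} u v u'' v''"
    and "\<And>i. i \<in> {1..<l} \<Longrightarrow> u'' i = u' i" "\<And>i. i \<in> {1..<l} \<Longrightarrow> v'' i = v' i"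
    using G0_orbit_eqE[OF e l eq] by blast
  with transv_zero_iff[OF tr] transv_dot[OF tr]
  show "(\<forall>i\<in>{1..<l}. u i = 0) \<longleftrightarrow> (\<forall>i\<in>{1..<l}. u' i = 0)"
    and "(\<forall>i\<in>{1..<l}. v i = 0) \<longleftrightarrow> (\<forall>i\<in>{1..<l}. v' i = 0)"
    and "(\<Sum>i=1..<l. u i * v i) = (\<Sum>i=1..<l. u' i * v' i)" by auto
qed

abbreviation single :: "nat \<Rightarrow> 'k::zero \<Rightarrow> nat \<Rightarrow> 'k" where
  "single i c \<equiv> \<lambda>k. if k = i then c else 0"

lemma rho_eq: "rho l = eps_diff l 0 1"
  by (simp add: simple_root_def)

lemma sigma_eq: "sigma l = eps_diff l (l - 1) l"
  by (simp add: simple_root_def)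

lemma max_root_minus_rho_eq: "l \<ge> 1 \<Longrightarrow> max_root l - rho l = eps_diff l 1 l"
  unfolding max_root_eq rho_eq by auto

lemma simple_root_vectors:
  assumes e: "chevalley_basis l e" and l: "l \<ge> 2"
  shows "root_vector e (rho l) = V1_mat l (single 1 (root_coeff l e 0 1)) (\<lambda>_. 0)"
    and "root_vector e (sigma l) = V1_mat l (\<lambda>_. 0) (single (l - 1) (root_coeff l e (l - 1) l))"
    and "root_vector e (max_root l - rho l) = V1_mat l (\<lambda>_. 0) (single 1 (root_coeff l e 1 l))"
proof -
  show "root_vector e (rho l) = V1_mat l (single 1 (root_coeff l e 0 1)) (\<lambda>_. 0)"
    unfolding rho_eq using l by (intro root_vector_row[OF e]) auto
  show "root_vector e (sigma l) = V1_mat l (\<lambda>_. 0) (single (l - 1) (root_coeff l e (l - 1) l))"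
    unfolding sigma_eq using l by (intro root_vector_col[OF e]) auto
  have "max_root l - rho l = eps_diff l 1 l" using l by (intro max_root_minus_rho_eq) simp
  then show "root_vector e (max_root l - rho l) = V1_mat l (\<lambda>_. 0) (single 1 (root_coeff l e 1 l))"
    using l by (simp only:) (intro root_vector_col[OF e], auto)
qed

lemma simple_root_vector_combinations:
  assumes e: "chevalley_basis l e" and l: "l \<ge> 2"
  shows "root_vector e (rho l) + a \<cdot>\<^sub>m root_vector e (sigma l) =
      V1_mat l (single 1 (root_coeff l e 0 1)) (single (l - 1) (a * root_coeff l e (l - 1) l))"
    and "root_vector e (rho l) + a \<cdot>\<^sub>m root_vector e (max_root l - rho l) =
      V1_mat l (single 1 (root_coeff l e 0 1)) (single 1 (a * root_coeff l e 1 l))"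
  unfolding simple_root_vectors[OF assms] V1_mat_smult V1_mat_add V1_mat_eq_iff by auto

text \<open>Instance of \<open>transv_normal_form\<close> with p = 1, q = l - 1 and the root
  coefficients of \<open>rho\<close> and \<open>sigma\<close> as target entries.\<close>

lemma V1_normal_form:
  fixes x :: "'k::field mat"
  assumes e: "chevalley_basis l e" and l: "l \<ge> 3" and x: "x \<in> V1 l e"
  obtains g where "g \<in> carrier (G0 l e)" and
    "G0_action l e g x = 0\<^sub>m (Suc l) (Suc l) \<or>
     G0_action l e g x = root_vector e (rho l) \<or>
     G0_action l e g x = root_vector e (sigma l) \<or>
     (\<exists>a. a \<noteq> 0 \<and> (l > 3 \<longrightarrow> a = 1) \<and>
       G0_action l e g x = root_vector e (rho l) + a \<cdot>\<^sub>m root_vector e (sigma l)) \<or>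
     (\<exists>a. a \<noteq> 0 \<and>
       G0_action l e g x = root_vector e (rho l) + a \<cdot>\<^sub>m root_vector e (max_root l - rho l))"
proof -
  have l1: "l \<ge> 1" and l2: "l \<ge> 2" using l by auto
  let ?S = "{1..<l}"
  obtain u0 v0 where x0: "x = V1_mat l u0 v0" using x unfolding V1_eq[OF e l1] by auto
  \<comment> \<open>Cut off outside \<open>{1..<l}\<close>, as the normal form requires; the matrix
    does not change.\<close>
  define u where "u = (\<lambda>k. if k \<in> ?S then u0 k else 0)"
  define v where "v = (\<lambda>k. if k \<in> ?S then v0 k else 0)"
  have x: "x = V1_mat l u v" unfolding x0 V1_mat_eq_iff u_def v_def by simp
  have out: "\<forall>k. k \<notin> ?S \<longrightarrow> u k = 0 \<and> v k = 0" by (simp add: u_def v_def)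
  let ?b = "root_coeff l e 0 1 :: 'k" and ?c = "root_coeff l e (l - 1) l :: 'k" and ?d = "root_coeff l e 1 l :: 'k"
  have nz: "?b \<noteq> 0" "?c \<noteq> 0" "?d \<noteq> 0"
    using l by (intro root_coeff_nonzero[OF e]; simp)+
  have S: "1 \<in> ?S" "l - 1 \<in> ?S" "1 \<noteq> l - 1" "finite ?S" using l by auto
  have act: "\<exists>g\<in>carrier (G0 l e). G0_action l e g x = V1_mat l u' v'"
    if "transv ?S u v u' v'" for u' v'
    unfolding x by (rule transv_imp_G0_action[OF e l1 that])
  note vec = simple_root_vectors[OF e l2]
    and comb = simple_root_vector_combinations[OF e l2]
  show ?thesis
    using S nz(1,2) out
  proof (cases rule: transv_normal_form)
    case 1
    with act[OF transv.refl] V1_mat_zero that show ?thesis by metis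
  next
    case 2
    from act[OF 2] that vec(1) show ?thesis by metis
  next
    case 3
    from act[OF 3] that vec(2) show ?thesis by metis
  next
    case (4 a)
    \<comment> \<open>Dividing by \<open>?c\<close> passes from the matrix entry to the coefficient
      of the root vector of \<open>sigma\<close>.\<close>
    have "a / ?c \<noteq> 0" using 4 nz by simp
    moreover have "a / ?c = 1" if "l > 3"
    proof -
      \<comment> \<open>For l > 3 the index 2 lies strictly between 1 and l - 1.\<close>
      have "\<exists>r\<in>?S. r \<noteq> 1 \<and> r \<noteq> l - 1" using that by (intro bexI[of _ 2]) auto
      with 4(3) nz show ?thesis by simp
    qed
    moreover have "a / ?c * ?c = a" using nz(2) by simp
    then have "V1_mat l (single 1 ?b) (single (l - 1) a) =
        root_vector e (rho l) + (a / ?c) \<cdot>\<^sub>m root_vector e (sigma l)"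
      unfolding comb by (simp only:)
    ultimately show ?thesis using act[OF 4(1)] that by metis
  next
    case (5 a)
    have "a / ?d \<noteq> 0" using 5 nz by simp
    moreover have "a / ?d * ?d = a" using nz(3) by simp
    then have "V1_mat l (single 1 ?b) (single 1 a) =
        root_vector e (rho l) + (a / ?d) \<cdot>\<^sub>m root_vector e (max_root l - rho l)"
      unfolding comb by (simp only:)
    ultimately show ?thesis using act[OF 5(1)] that by metis
  qed
qed

section \<open>Separation of the normal forms\<close>

lemma ball_single: "(\<forall>i\<in>S. single k c i = 0) \<longleftrightarrow> k \<notin> S \<or> c = 0"
  by auto

lemma sum_single_single:
  assumes "finite S"
  shows "(\<Sum>i\<in>S. single p a i * single q (b :: 'k::field) i) = (if p \<in> S \<and> p = q then a * b else 0)"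
proof -
  have "(\<Sum>i\<in>S. single p a i * single q b i) = (\<Sum>i\<in>S. if i = p then a * single q b p else 0)"
    by (rule sum.cong) auto
  then show ?thesis using assms by auto
qed

text \<open>Which of row and column vanish separates I, IIa, IIb and III, all with scalar product 0.
  For VI the scalar product is a nonzero multiple of the parameter, with a fixed factor.\<close>

lemma G0_orbit_form_vector_inj:
  fixes f f' :: "'k::field form"
  assumes e: "chevalley_basis l e" and l: "l > 3" and f: "f \<in> forms" "f' \<in> forms"
    and eq: "G0_orbit l e (form_vector l e f) = G0_orbit l e (form_vector l e f')"
  shows "f = f'"
proof -
  have l1: "l \<ge> 1" and l2: "l \<ge> 2" using l by auto
  let ?b = "root_coeff l e 0 1 :: 'k" and ?c = "root_coeff l e (l - 1) l :: 'k" and ?d = "root_coeff l e 1 l :: 'k"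
  have nz: "?b \<noteq> 0" "?c \<noteq> 0" "?d \<noteq> 0"
    using l by (intro root_coeff_nonzero[OF e]; simp)+
  define U :: "'k form \<Rightarrow> nat \<Rightarrow> 'k" where
    \<comment> \<open>A zero row is written as \<open>single 1 0\<close> so that the rules for
      \<open>single\<close> cover all types uniformly.\<close>
    "U f = (case f of I \<Rightarrow> single 1 0 | IIb \<Rightarrow> single 1 0 | _ \<Rightarrow> single 1 ?b)" for f
  define V :: "'k form \<Rightarrow> nat \<Rightarrow> 'k" where
    "V f = (case f of I \<Rightarrow> single 1 0 | IIa \<Rightarrow> single 1 0 | VI a \<Rightarrow> single 1 (a * ?d) | _ \<Rightarrow> single (l - 1) ?c)" for f
  have form: "form_vector l e f = V1_mat l (U f) (V f)" for f
    by (cases f)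
      (simp_all only: form_vector.simps form.case U_def V_def simple_root_vectors[OF e l2]
        V1_mat_smult V1_mat_add V1_mat_zero[symmetric] V1_mat_eq_iff, simp_all)
  have S: "1 \<in> {1..<l}" "l - 1 \<in> {1..<l}" "1 \<noteq> l - 1" using l by auto
  show ?thesis
    using G0_orbit_invariants[OF e l1 eq[unfolded form]] f nz S
    unfolding U_def V_def forms_def
    by (cases f; cases f')
      (simp_all only: form.case ball_single sum_single_single finite_atLeastLessThan, auto)
qed

text \<open>The invariants used for l > 3 separate everything except two vectors of type III with
  different parameters; these are separated by the symplectic form.\<close>

lemma G0_orbit_form3_vector_inj:
  fixes f f' :: "'k::field form3"
  assumes e: "chevalley_basis 3 e" and f: "f \<in> forms3" "f' \<in> forms3"
    and eq: "G0_orbit 3 e (form3_vector e f) = G0_orbit 3 e (form3_vector e f')"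
  shows "f = f'"
proof -
  have l1: "3 \<ge> (1::nat)" and l2: "3 \<ge> (2::nat)" by auto
  let ?b = "root_coeff 3 e 0 1 :: 'k" and ?c = "root_coeff 3 e 2 3 :: 'k" and ?d = "root_coeff 3 e 1 3 :: 'k"
  have nz: "?b \<noteq> 0" "?c \<noteq> 0" "?d \<noteq> 0"
    by (intro root_coeff_nonzero[OF e]; simp)+
  define U :: "'k form3 \<Rightarrow> nat \<Rightarrow> 'k" where
    "U f = (case f of I3 \<Rightarrow> single 1 0 | IIb3 \<Rightarrow> single 1 0 | _ \<Rightarrow> single 1 ?b)" for f
  define V :: "'k form3 \<Rightarrow> nat \<Rightarrow> 'k" where
    "V f = (case f of I3 \<Rightarrow> single 1 0 | IIa3 \<Rightarrow> single 1 0 | IIb3 \<Rightarrow> single 2 ?c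
      | III3 a \<Rightarrow> single 2 (a * ?c) | VI3 a \<Rightarrow> single 1 (a * ?d))" for f
  have zero: "(0\<^sub>m 4 4 :: 'k mat) = V1_mat 3 (\<lambda>_. 0) (\<lambda>_. 0)"
    by (simp add: V1_mat_zero)
  have form: "form3_vector e f = V1_mat 3 (U f) (V f)" for f
    using l2
    by (cases f)
      (simp_all only: form3_vector.simps form3.case U_def V_def simple_root_vectors[OF e l2]
        V1_mat_smult V1_mat_add zero V1_mat_eq_iff, simp_all)
  have III: "a = a'" if "f = III3 a" "f' = III3 a'" for a a'
  proof -
    obtain u'' v'' where tr: "transv {1..<3} (U f) (V f) u'' v''"
      and u'': "\<And>i. i \<in> {1..<3} \<Longrightarrow> u'' i = U f' i" and v'': "\<And>i. i \<in> {1..<3} \<Longrightarrow> v'' i = V f' i"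
      using G0_orbit_eqE[OF e l1 eq[unfolded form]] by blast
    have "{1..<3} = {1, 2 :: nat}" by auto
    with tr have "transv {1, 2} (U f) (V f) u'' v''" by simp
    \<comment> \<open>The column of \<open>III3 a\<close> is the symplectic dual of its row times a
      c / b, and this factor is preserved.\<close>
    then have "v'' 2 = (a * ?c / ?b) * u'' 1"
      using transv_symplectic[of 1 2 "U f" "V f" u'' v'' "a * ?c / ?b"] that nz
      by (simp add: U_def V_def)
    then show "a = a'" using that nz u''[of 1] v''[of 2] by (simp add: U_def V_def)
  qed
  have S: "1 \<in> {1..<3::nat}" "2 \<in> {1..<3::nat}" "1 \<noteq> (2::nat)" by auto
  show ?thesis
  proof (cases "\<exists>a a'. f = III3 a \<and> f' = III3 a'")
    case True
    with III show ?thesis by blast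
  next
    case False
    with G0_orbit_invariants[OF e l1 eq[unfolded form]] f nz S show ?thesis
      unfolding U_def V_def forms3_def
      by (cases f; cases f')
        (simp_all only: form3.case ball_single sum_single_single finite_atLeastLessThan, auto)
  qed
qed

theorem mainTheorem2:
  fixes l :: nat and e :: "int vec \<Rightarrow> int mat"
  assumes "CHAR('k::field) \<noteq> 2"
    and "l \<ge> 1"
    and "chevalley_basis l e"
  shows
    "(l = 1 \<longrightarrow>
        V1 l e = {0\<^sub>m 2 2 :: 'k mat} \<and>
        G0_orbits l e = {{0\<^sub>m 2 2 :: 'k mat}}) \<and>
     (l = 2 \<longrightarrow>
        Phi1 l = {rho l, max_root l - rho l} \<and>
        (\<forall>a b :: 'k. {a \<cdot>\<^sub>m root_vector e (rho l) + b \<cdot>\<^sub>m root_vector e (max_root l - rho l)}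
           \<in> G0_orbits l e)) \<and>
     (l = 3 \<longrightarrow>
        (\<forall>x \<in> (V1 l e :: 'k mat set). \<exists>g \<in> carrier (G0 l e). \<exists>f \<in> forms3.
           G0_action l e g x = form3_vector e f) \<and>
        (\<forall>f \<in> forms3. \<forall>f' \<in> forms3. f \<noteq> f' \<longrightarrow>
           G0_orbit l e (form3_vector e f :: 'k mat) \<noteq> G0_orbit l e (form3_vector e f'))) \<and>
     (l > 3 \<longrightarrow>
        (\<forall>x \<in> (V1 l e :: 'k mat set). \<exists>g \<in> carrier (G0 l e). \<exists>f \<in> forms.
           G0_action l e g x = form_vector l e f) \<and>
        (\<forall>f \<in> forms. \<forall>f' \<in> forms. f \<noteq> f' \<longrightarrow>
           G0_orbit l e (form_vector l e f :: 'k mat) \<noteq> G0_orbit l e (form_vector l e f')))"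
proof (intro conjI impI)
  note l = assms(2) and e = assms(3)
  have orbit_singleton: "G0_orbit l e (V1_mat l u v) = {V1_mat l u (v :: nat \<Rightarrow> 'k)}" if "l \<le> 2" for u v
  proof -
    have "u' = u \<and> v' = v" if "transv {1..<l} u v u' v'" for u' v'
      using that \<open>l \<le> 2\<close> by (intro transv_subsingleton[OF that]) auto
    then show ?thesis unfolding G0_orbit_V1_mat[OF e l] using transv.refl by blast
  qed
  {
    assume "l = 1"
    then have "V1_mat l u v = 0\<^sub>m 2 2" for u v :: "nat \<Rightarrow> 'k"
      using V1_mat_zero[of l] V1_mat_eq_iff[of l u v "\<lambda>_. 0" "\<lambda>_. 0"]
      by (simp add: numeral_2_eq_2)
    then show V1: "V1 l e = {0\<^sub>m 2 2 :: 'k mat}" unfolding V1_eq[OF e l] by simp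
    have "G0_orbit l e (0\<^sub>m 2 2 :: 'k mat) = {0\<^sub>m 2 2}"
      using orbit_singleton \<open>l = 1\<close> \<open>\<And>u v. V1_mat l u v = 0\<^sub>m 2 2\<close> by simp
    then show "G0_orbits l e = {{0\<^sub>m 2 2 :: 'k mat}}" unfolding orbits_def V1 by simp
  }
  {
    assume "l = 2"
    then show "Phi1 l = {rho l, max_root l - rho l}"
      unfolding Phi1_eq[OF l] max_root_minus_rho_eq[OF l] unfolding rho_eq
      by (auto simp: numeral_2_eq_2 simp del: minus_vec_def)
    have l2: "l \<ge> 2" using \<open>l = 2\<close> by simp
    show "\<forall>a b :: 'k. {a \<cdot>\<^sub>m root_vector e (rho l) + b \<cdot>\<^sub>m root_vector e (max_root l - rho l)}
           \<in> G0_orbits l e"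
      unfolding simple_root_vectors[OF e l2] V1_mat_smult V1_mat_add orbits_def
      using orbit_singleton \<open>l = 2\<close> V1_mat_in_V1[OF e l] by blast
  }
  {
    assume "l = 3"
    show "\<forall>x \<in> (V1 l e :: 'k mat set). \<exists>g \<in> carrier (G0 l e). \<exists>f \<in> forms3.
           G0_action l e g x = form3_vector e f"
    proof
      fix x :: "'k mat" assume "x \<in> V1 l e"
      then obtain g where g: "g \<in> carrier (G0 l e)" and cases:
        "G0_action l e g x = form3_vector e I3 \<or>
         G0_action l e g x = form3_vector e IIa3 \<or>
         G0_action l e g x = form3_vector e IIb3 \<or>
         (\<exists>a. a \<noteq> 0 \<and> G0_action l e g x = form3_vector e (III3 a)) \<or>
         (\<exists>a. a \<noteq> 0 \<and> G0_action l e g x = form3_vector e (VI3 a))"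
        using V1_normal_form[OF e _ \<open>x \<in> V1 l e\<close>] \<open>l = 3\<close> by auto
      have "\<exists>f \<in> forms3. G0_action l e g x = form3_vector e f"
        using cases unfolding forms3_def by blast
      with g show "\<exists>g \<in> carrier (G0 l e). \<exists>f \<in> forms3. G0_action l e g x = form3_vector e f" ..
    qed
    show "\<forall>f \<in> forms3. \<forall>f' \<in> forms3. f \<noteq> f' \<longrightarrow>
           G0_orbit l e (form3_vector e f :: 'k mat) \<noteq> G0_orbit l e (form3_vector e f')"
      using G0_orbit_form3_vector_inj e unfolding \<open>l = 3\<close> by blast
  }
  {
    assume "l > 3"
    \<comment> \<open>Type III has no scalar in \<open>form_vector\<close>, whereas
      \<open>V1_normal_form\<close> yields the scalar 1.\<close>
    have one: "1 \<cdot>\<^sub>m A = A" for A :: "'k mat" by (rule eq_matI) auto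
    show "\<forall>x \<in> (V1 l e :: 'k mat set). \<exists>g \<in> carrier (G0 l e). \<exists>f \<in> forms.
           G0_action l e g x = form_vector l e f"
    proof
      fix x :: "'k mat" assume "x \<in> V1 l e"
      then obtain g where g: "g \<in> carrier (G0 l e)" and cases:
        "G0_action l e g x = form_vector l e I \<or>
         G0_action l e g x = form_vector l e IIa \<or>
         G0_action l e g x = form_vector l e IIb \<or>
         G0_action l e g x = form_vector l e III \<or>
         (\<exists>a. a \<noteq> 0 \<and> G0_action l e g x = form_vector l e (VI a))"
        using V1_normal_form[OF e _ \<open>x \<in> V1 l e\<close>] \<open>l > 3\<close> by (auto simp: one)
      have "\<exists>f \<in> forms. G0_action l e g x = form_vector l e f"
        using cases unfolding forms_def by blast
      with g show "\<exists>g \<in> carrier (G0 l e). \<exists>f \<in> forms. G0_action l e g x = form_vector l e f" ..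
    qed
    show "\<forall>f \<in> forms. \<forall>f' \<in> forms. f \<noteq> f' \<longrightarrow>
           G0_orbit l e (form_vector l e f :: 'k mat) \<noteq> G0_orbit l e (form_vector l e f')"
      using G0_orbit_form_vector_inj[OF e \<open>l > 3\<close>] by blast
  }
qed

end
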